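(* Let $1 \leq p \leq \infty$. For every $p$-finite countable persistence diagram $\alpha \in \overline{D}_p^{\triangle}(\mathbb{R}^2_<)$, the persistence landscape $\Lambda_\alpha$ belongs to $L^p(\mathbb{N} \times \mathbb{R})$, and the map $$\Lambda: \left(\overline{D}_p^{\triangle}(\mathbb{R}^2_<),\, W_p^{\triangle}\right) \to L^p(\mathbb{N} \times \mathbb{R}), \qquad \alpha \mapsto \Lambda_\alpha,$$ is a $1$-Lipschitz embedding; that is, $\Lambda$ is injective and $\|\Lambda_\alpha - \Lambda_{\alpha'}\|_p \leq W_p^{\triangle}(\alpha,\alpha')$ for all $\alpha, \alpha'$ in its domain.
   Context: Points. $\mathbb{R}^2_< = \{(b,d)\in\mathbb{R}^2 : b<d\}$, $\mathbb{R}^2_\leq = \{(b,d)\in\mathbb{R}^2 : b\leq d\}$, $\Delta = \{(b,b) : b \in\mathbb{R}\}$. The quotient set $\mathbb{R}^2_\leq/\Delta$ (collapsing $\Delta$ to one point, again written $\Delta$) has basepoint $\Delta$, so its non-basepoint elements are the points of $\mathbb{R}^2_<$. For $x=(b,d)\in\mathbb{R}^2_<$ the triangle function $\triangle_x:\mathbb{R}\to[0,\infty)$ is $\triangle_x(t) = \inf\{|t-a| : a\in\mathbb{R}\setminus(b,d)\}$, the distance to the complement of the open interval $(b,d)$; $\triangle_\Delta = 0$. Put $d_p(x,y)=\|\triangle_x-\triangle_y\|_p$, the $L^p$ norm for Lebesgue measure on $\mathbb{R}$. Persistence diagrams. A countable persistence diagram here is a countable (finite or countably infinite) formal sum (multiset)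 $\sum_i x_i$ of elements of $\mathbb{R}^2_<$; the empty sum is $0$. Finite ones are always $p$-finite. An infinite one $\sum_{i=1}^\infty x_i$ is $p$-finite if $\|(d_p(x_i,\Delta))_i\|_p<\infty$ when $p<\infty$, and if $\lim_{i\to\infty} d_\infty(x_i,\Delta)=0$ when $p=\infty$. $\overline{D}_p^{\triangle}(\mathbb{R}^2_<)$ is the set of $p$-finite countable persistence diagrams. Wasserstein distance. For finite sums, $$W_p^{\triangle}\Big(\sum_{i=1}^m x_i, \sum_{i=1}^n y_i\Big) = \min_{\sigma \in \Sigma_{m+n}} \left\| (d_p(x_i,y_{\sigma(i)}))_{i=1}^{m+n} \right\|_p,$$ where $x_{m+1}=\cdots=x_{m+n}=\Delta=y_{n+1}=\cdots=y_{n+m}$ and $\Sigma_{m+n}$ is the symmetric group on $\{1,\dots,m+n\}$. For $p$-finite countable sums, $$W_p^{\triangle}\Big(\sum_{i=1}^\infty x_i,\sum_{i=1}^\infty y_i\Big) = \lim_{n\to\infty} W_p^{\triangle}\Big(\sum_{i=1}^n x_i,\sum_{i=1}^n y_i\Big),$$ where finite sums are regarded as infinite ones by appending copies of $\Delta$. This is a (complete) metric on $\overline{D}_p^{\triangle}(\mathbb{R}^2_<)$. Persistence landscape. For $\alpha=\sum_j x_j$, $\Lambda_\alpha(k,t) = \mathrm{kmax}\,(\triangle_{x_j}(t))_j$ for $k \in \mathbb{N} = \{1,2,\dots\}$, $t\in\mathbb{R}$, where $\mathrm{kmax}\, a$ denotes the $k$th largest element, counted with multiplicity, of a sequence $a$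 of nonnegative numbers. For a finite sequence with $n$ terms, $\mathrm{kmax}\, a = 0$ for $k>n$. For an infinite sequence $a$, let $L = \limsup a$ and let $b$ be the subsequence of terms larger than $L$: if $b$ has $N<\infty$ terms then $\mathrm{kmax}\, a = \mathrm{kmax}\, b$ for $k \leq N$ and $\mathrm{kmax}\, a = L$ for $k>N$; if $b$ is infinite, $a$ has a $k$th largest element for every $k$. (For $p$-finite diagrams, $L=0$ for every $t$.) $\mathbb{N}\times\mathbb{R}$ carries the product of counting measure and Lebesgue measure. *)

theory Defs
  imports "HOL-Probability.Essential_Supremum" "HOL-Library.Extended_Nat"
begin

section \<open>The \<open>L\<^sup>p\<close> norm, for \<open>1 \<le> p \<le> \<infinity>\<close>\<close>

definition ennreal_powr :: "ennreal \<Rightarrow> real \<Rightarrow> ennreal" where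
  "ennreal_powr a r = (if a = \<infinity> then \<infinity> else ennreal (enn2real a powr r))"

text \<open>The \<open>p\<close>-norm of a sequence is the special case where \<open>M\<close> is a counting measure.\<close>

definition Lp_norm :: "ennreal \<Rightarrow> 'a measure \<Rightarrow> ('a \<Rightarrow> real) \<Rightarrow> ennreal" where
  "Lp_norm p M f =
     (if p = \<infinity> then esssup M (\<lambda>x. ennreal \<bar>f x\<bar>)
      else ennreal_powr (\<integral>\<^sup>+ x. ennreal (\<bar>f x\<bar> powr enn2real p) \<partial>M) (1 / enn2real p))"

text \<open>Functions, not classes of functions: equality in \<open>L\<^sup>p\<close> is equality almost everywhere.\<close>

definition Lp_space :: "ennreal \<Rightarrow> 'a measure \<Rightarrow> ('a \<Rightarrow> real) set" where
  "Lp_space p M = {f \<in> borel_measurable M. Lp_norm p M f < \<infinity>}"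

section \<open>Points, and distances between them\<close>

text \<open>The quotient collapsing the diagonal to a point: \<^term>\<open>None\<close> is the basepoint \<open>\<Delta>\<close>, and
  \<^term>\<open>Some (b, d)\<close> is the point \<open>(b, d)\<close>, which is only meaningful for \<^prop>\<open>b < d\<close>.\<close>

type_synonym point = "(real \<times> real) option"

definition points :: "point set" where
  "points = insert None {Some (b, d) | b d. b < d}"

fun triangle :: "point \<Rightarrow> real \<Rightarrow> real" where
  "triangle None t = 0"
| "triangle (Some (b, d)) t = infdist t (- {b<..<d})"

text \<open>The norm is finite, since triangle functions are bounded with bounded support.\<close>

definition pt_dist :: "ennreal \<Rightarrow> point \<Rightarrow> point \<Rightarrow> real" where
  "pt_dist p x y = enn2real (Lp_norm p lborel (\<lambda>t. triangle x t - triangle y t))"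

section \<open>Countable persistence diagrams\<close>

text \<open>A multiset is given by its multiplicity function. The value \<open>\<infinity>\<close> is needed, as a
  countable formal sum may repeat a point infinitely often.\<close>

type_synonym diagram = "real \<times> real \<Rightarrow> enat"

text \<open>\<open>\<alpha> = \<Sum>\<^sub>i x i\<close>. Terms equal to \<open>\<Delta>\<close> do not count, so that a finite sum is written as an infinite
  one by appending copies of \<open>\<Delta>\<close>.\<close>

definition is_sum :: "diagram \<Rightarrow> (nat \<Rightarrow> point) \<Rightarrow> bool" where
  "is_sum \<alpha> x \<longleftrightarrow> range x \<subseteq> points \<and>
     (\<forall>z. \<alpha> z = (if finite {i. x i = Some z} then enat (card {i. x i = Some z}) else \<infinity>))"

text \<open>Finite diagrams satisfy the two conditions, since almost all of their distances to \<open>\<Delta>\<close>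
  are zero.\<close>

definition p_finite_seq :: "ennreal \<Rightarrow> (nat \<Rightarrow> point) \<Rightarrow> bool" where
  "p_finite_seq p x \<longleftrightarrow>
     (if p = \<infinity> then (\<lambda>i. pt_dist \<infinity> (x i) None) \<longlonglongrightarrow> 0
      else Lp_norm p (count_space UNIV) (\<lambda>i. pt_dist p (x i) None) < \<infinity>)"

definition p_finite_diagrams :: "ennreal \<Rightarrow> diagram set" where
  "p_finite_diagrams p = {\<alpha>. \<exists>x. is_sum \<alpha> x \<and> p_finite_seq p x}"

section \<open>The Wasserstein distance\<close>

text \<open>The distance between \<open>x 0 + \<dots> + x (m - 1)\<close> and \<open>y 0 + \<dots> + y (n - 1)\<close>.\<close>

definition W_fin :: "ennreal \<Rightarrow> nat \<Rightarrow> (nat \<Rightarrow> point) \<Rightarrow> nat \<Rightarrow> (nat \<Rightarrow> point) \<Rightarrow> ennreal" where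
  "W_fin p m x n y =
     (let x' = (\<lambda>i. if i < m then x i else None);
          y' = (\<lambda>i. if i < n then y i else None)
      in Min ((\<lambda>\<sigma>. Lp_norm p (count_space {..<m + n}) (\<lambda>i. pt_dist p (x' i) (y' (\<sigma> i))))
              ` {\<sigma>. \<sigma> permutes {..<m + n}}))"

text \<open>For \<open>p\<close>-finite diagrams the limit exists and is the same for all ways of writing them
  as sums.\<close>

definition W :: "ennreal \<Rightarrow> diagram \<Rightarrow> diagram \<Rightarrow> ennreal" where
  "W p \<alpha> \<beta> = (THE w. \<forall>x y. is_sum \<alpha> x \<longrightarrow> is_sum \<beta> y \<longrightarrow> (\<lambda>n. W_fin p n x n y) \<longlonglongrightarrow> w)"

section \<open>The persistence landscape\<close>

text \<open>The \<open>k\<close>th largest term of \<open>a\<close>, counted with multiplicity, for \<^prop>\<open>k \<ge> 1\<close>: it is taken among the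
  terms above the limit superior if there are enough of them, and is characterised by fewer
  than \<open>k\<close> terms being larger and at least \<open>k\<close> terms being at least as large. In this case the
  sets being counted are finite.

  A finite sequence of \<open>n\<close> nonnegative terms may be extended by zeros, as its \<open>k\<close>th largest term
  is \<open>0\<close> for \<^prop>\<open>k > n\<close>.\<close>

definition kmax :: "nat \<Rightarrow> (nat \<Rightarrow> 'a::complete_linorder) \<Rightarrow> 'a" where
  "kmax k a =
     (let L = limsup a; B = {i. a i > L}
      in if finite B \<and> card B < k then L
         else (THE v. v \<in> a ` B \<and> card {i \<in> B. a i > v} < k \<and> k \<le> card {i \<in> B. a i \<ge> v}))"

text \<open>The order in which the points are listed does not matter. The value of \<open>kmax\<close> is finite for
  \<open>p\<close>-finite diagrams.\<close>

definition landscape :: "diagram \<Rightarrow> nat \<times> real \<Rightarrow> real" where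
  "landscape \<alpha> = (\<lambda>(k, t).
     enn2real (THE v. \<forall>x. is_sum \<alpha> x \<longrightarrow> v = kmax k (\<lambda>j. ennreal (triangle (x j) t))))"

definition landscape_measure :: "(nat \<times> real) measure" where
  "landscape_measure = count_space {1..} \<Otimes>\<^sub>M lborel"

end

theory Submission
  imports Defs
begin

text \<open>
  Everything rests on describing both sides by listings of a diagram, that is by sequences \<open>x\<close> with
  \<open>\<alpha> = \<Sum>\<^sub>i x i\<close>, in which the basepoint may be inserted freely. A pair of listings \<open>(u, v)\<close> of \<open>\<alpha>\<close> and \<open>\<beta>\<close>
  is a coupling: it matches \<open>u i\<close> with \<open>v i\<close>, and a point facing the basepoint is unmatched. So the
  choice of a matching is the choice of the listings.

  Lipschitz continuity. For a coupling \<open>(u, v)\<close> and a fixed \<open>t\<close>, the landscapes of \<open>\<alpha>\<close> and \<open>\<beta>\<close> at \<open>t\<close> are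
  the decreasing rearrangements of \<open>i \<mapsto> \<triangle>\<^bsub>u i\<^esub>(t)\<close> and \<open>i \<mapsto> \<triangle>\<^bsub>v i\<^esub>(t)\<close>. Rearranging two sequences in decreasing
  order does not increase their \<open>\<ell>\<^sup>p\<close> distance (\<open>kth_cost\<close>, and \<open>kth_lipschitz\<close> for \<open>p = \<infinity>\<close>): for
  finite sequences, convexity of \<open>|\<cdot>|\<^sup>p\<close> allows one to match the two maxima with each other and to
  recurse, and the general case is a limit of truncations. Integrating over \<open>t\<close> and exchanging the
  sum with the integral bounds the distance of the landscapes by the cost
  \<open>\<parallel>(d\<^sub>p(u i, v i))\<^sub>i\<parallel>\<^sub>p\<close> of the coupling (\<open>Lp_norm_landscape_diff_le_cost\<close>). Coupling \<open>\<alpha>\<close> with the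
  empty diagram shows that the landscape of \<open>\<alpha>\<close> is in \<open>L\<^sup>p\<close>.

  It remains to see that the Wasserstein distance is the infimum of these costs
  (\<open>W_eq_coupling_dist\<close>). For diagrams with at most \<open>n\<close> points each, a coupling is carried by \<open>2 n\<close>
  indices and so is the same thing as a permutation of \<open>2 n\<close> slots. In general the infimum
  satisfies the triangle inequality, by Minkowski's inequality and because two couplings can be
  glued along their common diagram. The coupling of a diagram with its \<open>n\<close>th truncation costs the norm
  of a tail, which tends to \<open>0\<close> for \<open>p\<close>-finite diagrams; hence the distances of the truncations
  converge to the infimum, for all listings.

  Injectivity. At fixed \<open>k\<close> a landscape is 1-Lipschitz in \<open>t\<close>, so two landscapes that agree almost
  everywhere agree everywhere (\<open>landscape_AE_eq_imp_eq\<close>). The values at \<open>t\<close> determine, for every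
  \<open>s > 0\<close>, the number of points with \<open>\<triangle>\<^sub>x(t) \<ge> s\<close>, which is the number of points \<open>(b, d)\<close> with
  \<open>b \<le> t - s\<close> and \<open>d \<ge> t + s\<close>. These counts are finite, and looking, inside a suitable
  quadrant, at a point of greatest persistence among those where the multiplicities of two diagrams
  differ shows that they determine the diagram
  (\<open>diagram_eq_if_kth_eq\<close>).
\<close>

section \<open>The \<open>L\<^sup>p\<close> norm\<close>

text \<open>This reduces inequalities between norms to real upper bounds, which have the same form for
  finite and for infinite \<open>p\<close>.\<close>

lemma ennreal_le_by_bounds:
  fixes a b :: ennreal
  assumes "\<And>c. 0 \<le> c \<Longrightarrow> b \<le> ennreal c \<Longrightarrow> a \<le> ennreal c"
  shows "a \<le> b"
proof (cases b)
  case (real r)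
  then show ?thesis using assms[of r] by simp
qed simp

lemma enn2real_ge_1: "1 \<le> p \<Longrightarrow> p \<noteq> \<infinity> \<Longrightarrow> 1 \<le> enn2real (p::ennreal)"
  by (metis enn2real_1 enn2real_mono infinity_ennreal_def less_top)

lemma Lp_norm_top_le_iff:
  assumes "p = \<infinity>" "f \<in> borel_measurable M" "0 \<le> c"
  shows "Lp_norm p M f \<le> ennreal c \<longleftrightarrow> (AE x in M. \<bar>f x\<bar> \<le> c)"
proof
  assume l: "Lp_norm p M f \<le> ennreal c"
  have "AE x in M. ennreal \<bar>f x\<bar> \<le> esssup M (\<lambda>x. ennreal \<bar>f x\<bar>)"
    by (rule esssup_AE)
  then show "AE x in M. \<bar>f x\<bar> \<le> c"
    by eventually_elim (use l assms in \<open>auto simp: Lp_norm_def dest: order_trans\<close>)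
next
  assume "AE x in M. \<bar>f x\<bar> \<le> c"
  then show "Lp_norm p M f \<le> ennreal c"
    using assms by (auto simp: Lp_norm_def intro!: esssup_I)
qed

lemma ennreal_powr_le_iff:
  assumes "0 < q" "0 \<le> c"
  shows "ennreal_powr a (1 / q) \<le> ennreal c \<longleftrightarrow> a \<le> ennreal (c powr q)"
proof (cases a)
  case (real r)
  have "r powr (1/q) \<le> c \<longleftrightarrow> r \<le> c powr q"
  proof
    assume "r powr (1/q) \<le> c"
    then have "(r powr (1/q)) powr q \<le> c powr q"
      using assms by (intro powr_mono2) auto
    then show "r \<le> c powr q" using assms real by (simp add: powr_powr)
  next
    assume "r \<le> c powr q"
    then have "r powr (1/q) \<le> (c powr q) powr (1/q)"
      using assms real by (intro powr_mono2) auto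
    then show "r powr (1/q) \<le> c" using assms real by (simp add: powr_powr)
  qed
  then show ?thesis using real assms by (simp add: ennreal_powr_def)
qed (simp add: ennreal_powr_def top_unique)

text \<open>Powers with exponent \<open>1 / p\<close> are awkward in the extended reals. This and
  \<open>Lp_norm_top_le_iff\<close> turn every statement about norms into one about integrals of \<open>p\<close>th powers, or
  about almost everywhere bounds.\<close>

lemma Lp_norm_le_iff:
  assumes "1 \<le> p" "p \<noteq> \<infinity>" "0 \<le> c"
  shows "Lp_norm p M f \<le> ennreal c \<longleftrightarrow>
    (\<integral>\<^sup>+ x. ennreal (\<bar>f x\<bar> powr enn2real p) \<partial>M) \<le> ennreal (c powr enn2real p)"
  unfolding Lp_norm_def using assms enn2real_ge_1[OF assms(1,2)]
  by (simp add: ennreal_powr_le_iff)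

lemma Lp_norm_mono_AE:
  assumes "1 \<le> p" "f \<in> borel_measurable M" "g \<in> borel_measurable M"
    and "AE x in M. \<bar>f x\<bar> \<le> \<bar>g x\<bar>"
  shows "Lp_norm p M f \<le> Lp_norm p M g"
proof (rule ennreal_le_by_bounds)
  fix c :: real assume c: "0 \<le> c" "Lp_norm p M g \<le> ennreal c"
  show "Lp_norm p M f \<le> ennreal c"
  proof (cases "p = \<infinity>")
    case True
    have "AE x in M. \<bar>g x\<bar> \<le> c" using c True assms Lp_norm_top_le_iff by blast
    then have "AE x in M. \<bar>f x\<bar> \<le> c" using assms(4) by eventually_elim auto
    then show ?thesis using c True assms Lp_norm_top_le_iff by blast
  next
    case False
    have "(\<integral>\<^sup>+ x. ennreal (\<bar>f x\<bar> powr enn2real p) \<partial>M) \<le> (\<integral>\<^sup>+ x. ennreal (\<bar>g x\<bar> powr enn2real p) \<partial>M)"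
      using assms(4)
      by (intro nn_integral_mono_AE)
        (use enn2real_ge_1[OF assms(1) False] in \<open>auto elim!: eventually_mono intro!: ennreal_leI powr_mono2\<close>)
    then show ?thesis using c False assms by (auto simp: Lp_norm_le_iff)
  qed
qed

lemma powr_convex_combination:
  fixes x y u v q :: real
  assumes "1 \<le> q" "0 \<le> x" "0 \<le> y" "0 \<le> u" "0 \<le> v" "u + v = 1"
  shows "(u * x + v * y) powr q \<le> u * x powr q + v * y powr q"
proof -
  have scale: "(w * z) powr q \<le> w * z powr q" if "0 \<le> w" "w \<le> 1" "0 \<le> z" for w z :: real
  proof -
    have "w powr q \<le> w"
      using powr_mono'[of 1 q w] that assms(1) by (cases "w = 0") auto
    then show ?thesis using that by (simp add: powr_mult mult_right_mono)
  qed
  consider "x = 0" | "y = 0" | "x > 0" "y > 0" using assms by fastforce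
  then show ?thesis
  proof cases
    case 1 then show ?thesis using scale[of v y] assms by simp
  next
    case 2 then show ?thesis using scale[of u x] assms by simp
  next
    case 3
    have u: "u = 1 - v" "v \<le> 1" using assms by auto
    show ?thesis
      using convex_onD[OF powr_convex[OF assms(1)], of v x y] 3 assms(5) u(2) unfolding u(1) by simp
  qed
qed

text \<open>The proof of Minkowski's inequality that needs only convexity: after division by \<open>A + B\<close>, the
  function \<open>|f + g|\<close> is bounded by a convex combination of \<open>|f| / A\<close> and \<open>|g| / B\<close>, whose norms are at most 1.\<close>

lemma Lp_norm_add_le_pos:
  assumes p: "1 \<le> p" "p \<noteq> \<infinity>" and [measurable]: "f \<in> borel_measurable M" "g \<in> borel_measurable M"
    and AB: "0 < A" "0 < B" "Lp_norm p M f \<le> ennreal A" "Lp_norm p M g \<le> ennreal B"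
  shows "Lp_norm p M (\<lambda>x. f x + g x) \<le> ennreal (A + B)"
proof -
  define q where "q = enn2real p"
  have q: "1 \<le> q" using enn2real_ge_1[OF p] by (simp add: q_def)
  \<comment> \<open>\<open>\<bar>f x\<bar> + \<bar>g x\<bar>\<close> is \<open>A + B\<close> times the convex combination of \<open>\<bar>f x\<bar> / A\<close> and \<open>\<bar>g x\<bar> / B\<close> with weights \<open>A / (A + B)\<close> and \<open>B / (A + B)\<close>\<close>
  have pw: "\<bar>f x + g x\<bar> powr q \<le> (A + B) powr q * (A / (A + B) / A powr q) * \<bar>f x\<bar> powr q
      + (A + B) powr q * (B / (A + B) / B powr q) * \<bar>g x\<bar> powr q" for x
  proof -
    have "\<bar>f x + g x\<bar> powr q \<le> ((A + B) * (A / (A + B) * (\<bar>f x\<bar> / A) + B / (A + B) * (\<bar>g x\<bar> / B))) powr q"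
    proof (rule powr_mono2)
      have "(A + B) * (A / (A + B) * (\<bar>f x\<bar> / A) + B / (A + B) * (\<bar>g x\<bar> / B)) = \<bar>f x\<bar> + \<bar>g x\<bar>"
        using AB by (simp add: distrib_left)
      then show "\<bar>f x + g x\<bar> \<le> (A + B) * (A / (A + B) * (\<bar>f x\<bar> / A) + B / (A + B) * (\<bar>g x\<bar> / B))"
        by linarith
    qed (use q in auto)
    also have "\<dots> = (A + B) powr q * (A / (A + B) * (\<bar>f x\<bar> / A) + B / (A + B) * (\<bar>g x\<bar> / B)) powr q"
      by (rule powr_mult)
    also have "\<dots> \<le> (A + B) powr q * (A / (A + B) * (\<bar>f x\<bar> / A) powr q + B / (A + B) * (\<bar>g x\<bar> / B) powr q)"
      using AB q by (intro mult_left_mono powr_convex_combination) (auto simp: divide_simps)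
    also have "\<dots> = (A + B) powr q * (A / (A + B) / A powr q) * \<bar>f x\<bar> powr q
      + (A + B) powr q * (B / (A + B) / B powr q) * \<bar>g x\<bar> powr q"
      using AB by (simp add: powr_divide distrib_left)
    finally show ?thesis .
  qed
  have "(\<integral>\<^sup>+ x. ennreal (\<bar>f x + g x\<bar> powr q) \<partial>M)
      \<le> (\<integral>\<^sup>+ x. ennreal ((A + B) powr q * (A / (A + B) / A powr q)) * ennreal (\<bar>f x\<bar> powr q)
        + ennreal ((A + B) powr q * (B / (A + B) / B powr q)) * ennreal (\<bar>g x\<bar> powr q) \<partial>M)"
    using AB by (intro nn_integral_mono)
      (simp add: ennreal_mult[symmetric] ennreal_plus[symmetric] pw del: ennreal_plus times_divide_eq_left times_divide_eq_right divide_divide_eq_left)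
  also have "\<dots> = ennreal ((A + B) powr q * (A / (A + B) / A powr q)) * (\<integral>\<^sup>+ x. ennreal (\<bar>f x\<bar> powr q) \<partial>M)
      + ennreal ((A + B) powr q * (B / (A + B) / B powr q)) * (\<integral>\<^sup>+ x. ennreal (\<bar>g x\<bar> powr q) \<partial>M)"
    by (subst nn_integral_add) (auto simp: nn_integral_cmult)
  also have "\<dots> \<le> ennreal ((A + B) powr q * (A / (A + B) / A powr q)) * ennreal (A powr q)
      + ennreal ((A + B) powr q * (B / (A + B) / B powr q)) * ennreal (B powr q)"
    using AB p by (intro add_mono mult_left_mono) (auto simp: Lp_norm_le_iff q_def)
  also have "\<dots> = ennreal ((A + B) powr q * (A / (A + B)) + (A + B) powr q * (B / (A + B)))"
    using AB by (simp add: ennreal_mult[symmetric] ennreal_plus[symmetric] del: ennreal_plus)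
  also have "(A + B) powr q * (A / (A + B)) + (A + B) powr q * (B / (A + B)) = (A + B) powr q"
    using AB by (simp add: distrib_left[symmetric] add_divide_distrib[symmetric] del: times_divide_eq_right)
  finally show ?thesis using p AB by (simp add: Lp_norm_le_iff q_def del: ennreal_plus)
qed

text \<open>Enlarging both bounds by \<open>e / 2\<close> avoids a separate treatment of functions of norm zero.\<close>

lemma Lp_norm_add_le:
  assumes p: "1 \<le> p" and [measurable]: "f \<in> borel_measurable M" "g \<in> borel_measurable M"
  shows "Lp_norm p M (\<lambda>x. f x + g x) \<le> Lp_norm p M f + Lp_norm p M g"
proof (cases "Lp_norm p M f = \<infinity> \<or> Lp_norm p M g = \<infinity>")
  case False
  then obtain A B where A: "0 \<le> A" "Lp_norm p M f = ennreal A" and B: "0 \<le> B" "Lp_norm p M g = ennreal B"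
    by (metis ennreal_cases infinity_ennreal_def)
  show ?thesis
  proof (cases "p = \<infinity>")
    case True
    have "AE x in M. \<bar>f x\<bar> \<le> A" "AE x in M. \<bar>g x\<bar> \<le> B"
      using A B True by (auto simp flip: Lp_norm_top_le_iff)
    then have "AE x in M. \<bar>f x + g x\<bar> \<le> A + B" by eventually_elim auto
    then have "Lp_norm p M (\<lambda>x. f x + g x) \<le> ennreal (A + B)"
      using A B True by (simp add: Lp_norm_top_le_iff del: ennreal_plus)
    then show ?thesis using A B by simp
  next
    case False
    show ?thesis
    proof (rule ennreal_le_epsilon)
      fix e :: real assume e: "0 < e"
      have "Lp_norm p M (\<lambda>x. f x + g x) \<le> ennreal ((A + e/2) + (B + e/2))"
        using A B e by (intro Lp_norm_add_le_pos p False) (auto intro!: ennreal_leI simp del: ennreal_plus)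
      also have "\<dots> = Lp_norm p M f + Lp_norm p M g + ennreal e"
        using A B e by (simp add: ennreal_plus[symmetric] algebra_simps del: ennreal_plus)
      finally show "Lp_norm p M (\<lambda>x. f x + g x) \<le> Lp_norm p M f + Lp_norm p M g + ennreal e" .
    qed
  qed
qed auto

lemma Lp_norm_zero: "1 \<le> p \<Longrightarrow> Lp_norm p M (\<lambda>x. 0) = 0"
proof -
  assume "1 \<le> p"
  then have "Lp_norm p M (\<lambda>x. 0) \<le> ennreal 0"
    by (cases "p = \<infinity>") (simp_all add: Lp_norm_top_le_iff Lp_norm_le_iff del: ennreal_0, simp)
  then show ?thesis by simp
qed

text \<open>The common form of all changes of index: reordering, insertion and deletion of terms that
  vanish, and restriction to a subset.\<close>

lemma Lp_norm_count_space_inj_le: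
  fixes f :: "'a \<Rightarrow> real" and g :: "'b \<Rightarrow> real"
  assumes p: "1 \<le> p" and inj: "inj_on h {i \<in> A. f i \<noteq> 0}" and im: "h ` {i \<in> A. f i \<noteq> 0} \<subseteq> B"
    and le: "\<And>i. i \<in> A \<Longrightarrow> f i \<noteq> 0 \<Longrightarrow> \<bar>f i\<bar> \<le> \<bar>g (h i)\<bar>"
  shows "Lp_norm p (count_space A) f \<le> Lp_norm p (count_space B) g"
proof (rule ennreal_le_by_bounds)
  fix c :: real assume c: "0 \<le> c" "Lp_norm p (count_space B) g \<le> ennreal c"
  show "Lp_norm p (count_space A) f \<le> ennreal c"
  proof (cases "p = \<infinity>")
    case True
    have "\<forall>j\<in>B. \<bar>g j\<bar> \<le> c" using c True by (simp add: Lp_norm_top_le_iff AE_count_space)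
    then have "\<forall>i\<in>A. \<bar>f i\<bar> \<le> c" using im le c(1) 
      by (metis (mono_tags, lifting) abs_zero image_subset_iff mem_Collect_eq order_trans)
    then show ?thesis using c True by (simp add: Lp_norm_top_le_iff AE_count_space)
  next
    case False
    define q where "q = enn2real p"
    have q: "1 \<le> q" using enn2real_ge_1[OF p False] by (simp add: q_def)
    let ?S = "{i \<in> A. f i \<noteq> 0}"
    have "(\<integral>\<^sup>+ i. ennreal (\<bar>f i\<bar> powr q) \<partial>count_space A) = (\<integral>\<^sup>+ i. ennreal (\<bar>f i\<bar> powr q) \<partial>count_space ?S)"
      by (rule nn_integral_count_space_eq) auto
    also have "\<dots> \<le> (\<integral>\<^sup>+ i. ennreal (\<bar>g (h i)\<bar> powr q) \<partial>count_space ?S)"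
      using le q by (intro nn_integral_mono ennreal_leI powr_mono2) auto
    also have "\<dots> = (\<integral>\<^sup>+ j. ennreal (\<bar>g j\<bar> powr q) \<partial>count_space (h ` ?S))"
      by (rule nn_integral_bij_count_space) (use inj in \<open>simp add: bij_betw_def\<close>)
    also have "\<dots> = (\<integral>\<^sup>+ j. ennreal (\<bar>g j\<bar> powr q) * indicator (h ` ?S) j \<partial>count_space B)"
      using im by (subst nn_integral_restrict_space[symmetric]) (auto simp: restrict_count_space Int_absorb2)
    also have "\<dots> \<le> (\<integral>\<^sup>+ j. ennreal (\<bar>g j\<bar> powr q) \<partial>count_space B)"
      by (intro nn_integral_mono) (auto split: split_indicator)
    finally show ?thesis using c p False by (auto simp: Lp_norm_le_iff q_def)
  qed
qed

lemma le_Lp_norm_count_space: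
  assumes "1 \<le> p" "i \<in> A"
  shows "ennreal \<bar>f i\<bar> \<le> Lp_norm p (count_space A) f"
proof (rule ennreal_le_by_bounds)
  fix c :: real assume c: "0 \<le> c" "Lp_norm p (count_space A) f \<le> ennreal c"
  show "ennreal \<bar>f i\<bar> \<le> ennreal c"
  proof (cases "p = \<infinity>")
    case True
    then show ?thesis using c assms by (simp add: Lp_norm_top_le_iff AE_count_space)
  next
    case False
    define q where "q = enn2real p"
    have q: "1 \<le> q" using enn2real_ge_1[OF assms(1) False] by (simp add: q_def)
    have "ennreal (\<bar>f i\<bar> powr q) \<le> (\<integral>\<^sup>+ i. ennreal (\<bar>f i\<bar> powr q) \<partial>count_space A)"
      using nn_integral_ge_point[OF assms(2), of "\<lambda>i. ennreal (\<bar>f i\<bar> powr q)"] by simp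
    also have "\<dots> \<le> ennreal (c powr q)" using c assms False by (simp add: Lp_norm_le_iff q_def)
    finally have "\<bar>f i\<bar> powr q \<le> c powr q" by simp
    then show ?thesis using q c(1) by (smt (verit) ennreal_leI powr_less_mono2)
  qed
qed

text \<open>For finite \<open>p\<close> this is dominated convergence of the sums of \<open>p\<close>th powers. The hypothesis is the one in
  the definition of \<open>p\<close>-finiteness, which for \<open>p = \<infinity>\<close> asks for a null sequence.\<close>

lemma Lp_norm_tail_tendsto_0:
  fixes f :: "nat \<Rightarrow> real"
  assumes p: "1 \<le> p"
    and f: "if p = \<infinity> then f \<longlonglongrightarrow> 0 else Lp_norm p (count_space UNIV) f < \<infinity>"
  shows "(\<lambda>n. Lp_norm p (count_space UNIV) (\<lambda>i. if i < n then 0 else f i)) \<longlonglongrightarrow> 0"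
proof -
  have small: "\<forall>\<^sub>F n in sequentially. Lp_norm p (count_space UNIV) (\<lambda>i. if i < n then 0 else f i) \<le> ennreal e"
    if e: "0 < e" for e
  proof (cases "p = \<infinity>")
    case True
    then have "\<forall>\<^sub>F n in sequentially. \<bar>f n\<bar> < e"
      using f e by (auto simp: tendsto_iff)
    then obtain N where N: "\<And>n. n \<ge> N \<Longrightarrow> \<bar>f n\<bar> < e" by (auto simp: eventually_sequentially)
    show ?thesis
      using True e by (auto simp: Lp_norm_top_le_iff AE_count_space eventually_sequentially intro!: exI[of _ N] less_imp_le[OF N])
  next
    case False
    define q where "q = enn2real p"
    have q: "1 \<le> q" using enn2real_ge_1[OF p False] by (simp add: q_def)
    from f False obtain c where "0 \<le> c" "Lp_norm p (count_space UNIV) f = ennreal c"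
      by (cases "Lp_norm p (count_space UNIV) f") auto
    then have fin: "(\<integral>\<^sup>+ i. ennreal (\<bar>f i\<bar> powr q) \<partial>count_space UNIV) \<le> ennreal (c powr q)"
      using p False by (simp add: q_def flip: Lp_norm_le_iff)
    have "(\<lambda>n. \<integral>\<^sup>+ i. ennreal (\<bar>if i < n then 0 else f i\<bar> powr q) \<partial>count_space UNIV)
        \<longlonglongrightarrow> (\<integral>\<^sup>+ i. 0 \<partial>count_space (UNIV::nat set))"
    proof (rule nn_integral_dominated_convergence[where w="\<lambda>i. ennreal (\<bar>f i\<bar> powr q)"])
      show "(\<integral>\<^sup>+ i. ennreal (\<bar>f i\<bar> powr q) \<partial>count_space UNIV) < \<infinity>"
        using fin by (auto simp: less_top[symmetric] top_unique)
      show "AE i in count_space UNIV. (\<lambda>n. ennreal (\<bar>if i < n then 0 else f i\<bar> powr q)) \<longlonglongrightarrow> 0"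
      proof (rule AE_I2)
        fix i :: nat
        have "\<forall>\<^sub>F n in sequentially. ennreal (\<bar>if i < n then 0 else f i\<bar> powr q) = 0"
          using eventually_gt_at_top[of i] by eventually_elim auto
        then show "(\<lambda>n. ennreal (\<bar>if i < n then 0 else f i\<bar> powr q)) \<longlonglongrightarrow> 0"
          by (rule tendsto_eventually)
      qed
    qed auto
    then have "(\<lambda>n. \<integral>\<^sup>+ i. ennreal (\<bar>if i < n then 0 else f i\<bar> powr q) \<partial>count_space UNIV) \<longlonglongrightarrow> 0" by simp
    moreover have "0 < ennreal (e powr q)" using e by simp
    ultimately have "\<forall>\<^sub>F n in sequentially. (\<integral>\<^sup>+ i. ennreal (\<bar>if i < n then 0 else f i\<bar> powr q) \<partial>count_space UNIV) < ennreal (e powr q)"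
      by (rule order_tendstoD)
    then show ?thesis
      by eventually_elim (use e False p in \<open>simp add: Lp_norm_le_iff q_def\<close>)
  qed
  show ?thesis
  proof (rule order_tendstoI)
    fix a :: ennreal assume "0 < a"
    then obtain e where "0 < e" "ennreal e < a"
      by (metis dense ennreal_cases ennreal_less_zero_iff less_top_ennreal not_less_iff_gr_or_eq order_less_trans top.not_eq_extremum)
    with small[of e] show "\<forall>\<^sub>F n in sequentially. Lp_norm p (count_space UNIV) (\<lambda>i. if i < n then 0 else f i) < a"
      by (auto elim: eventually_mono)
  qed auto
qed

section \<open>The \<open>k\<close>th largest term\<close>

text \<open>The \<open>k\<close>th largest term as a supremum over sets of \<open>k\<close> indices of the least term in the set.\<close>

definition kth :: "nat \<Rightarrow> (nat \<Rightarrow> ennreal) \<Rightarrow> ennreal" where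
  "kth k a = (SUP I\<in>{I. finite I \<and> card I = k}. INF i\<in>I. a i)"

lemma less_kth_iff:
  assumes "1 \<le> k"
  shows "s < kth k a \<longleftrightarrow> (\<exists>I. finite I \<and> card I = k \<and> (\<forall>i\<in>I. s < a i))"
proof -
  have "s < (INF i\<in>I. a i) \<longleftrightarrow> (\<forall>i\<in>I. s < a i)" if "finite I" "card I = k" for I
  proof -
    have "I \<noteq> {}" using that assms by auto
    then have "(INF i\<in>I. a i) = Min (a ` I)" using that by (simp add: cInf_eq_Min)
    then show ?thesis using that \<open>I \<noteq> {}\<close> by simp
  qed
  then show ?thesis by (auto simp: kth_def less_SUP_iff)
qed

lemma INF_le_kth: "finite I \<Longrightarrow> card I = k \<Longrightarrow> (\<And>i. i \<in> I \<Longrightarrow> s \<le> a i) \<Longrightarrow> s \<le> kth k a"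
  unfolding kth_def by (rule SUP_upper2) (auto intro: INF_greatest)

text \<open>The \<open>k\<close>th largest term depends only on the multiset of nonzero terms; this one-sided form
  gives monotonicity and invariance under reordering together.\<close>

lemma kth_mono_inj:
  assumes "1 \<le> k" "inj_on h {i. a i \<noteq> 0}" "\<And>i. a i \<noteq> 0 \<Longrightarrow> a i \<le> b (h i)"
  shows "kth k a \<le> kth k b"
proof (rule ccontr)
  assume "\<not> kth k a \<le> kth k b"
  then obtain I where I: "finite I" "card I = k" "\<forall>i\<in>I. kth k b < a i"
    using less_kth_iff[OF assms(1), of "kth k b" a] by (auto simp: not_le)
  then have sub: "I \<subseteq> {i. a i \<noteq> 0}" by force
  have "kth k b < kth k b"
    unfolding less_kth_iff[OF assms(1), of _ b]
  proof (intro exI[of _ "h ` I"] conjI ballI)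
    show "card (h ` I) = k" using I sub assms(2) card_image inj_on_subset by metis
    show "kth k b < b j" if "j \<in> h ` I" for j
      using that I sub assms(3) by (fastforce intro: order_less_le_trans)
  qed (use I in auto)
  then show False by simp
qed

lemma kth_le_add:
  assumes "1 \<le> k" "\<And>i. a i \<le> b i + c"
  shows "kth k a \<le> kth k b + c"
  unfolding kth_def[of k a]
proof (rule SUP_least)
  fix I :: "nat set" assume I: "I \<in> {I. finite I \<and> card I = k}"
  then have ne: "finite I" "I \<noteq> {}" using assms(1) by auto
  then obtain i where i: "i \<in> I" "\<And>j. j \<in> I \<Longrightarrow> b i \<le> b j"
    using arg_min_if_finite(1)[of I b] arg_min_least[of I _ b] by blast
  have "(INF i\<in>I. a i) \<le> a i" using i by (simp add: INF_lower)
  also have "\<dots> \<le> b i + c" by fact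
  also have "\<dots> \<le> kth k b + c" using i I by (intro add_right_mono INF_le_kth[of I]) auto
  finally show "(INF i\<in>I. a i) \<le> kth k b + c" .
qed

text \<open>The values \<open>kth k a\<close> for all \<open>k\<close> carry the same information as the counting function of the
  multiset of positive terms. This is what injectivity uses.\<close>

lemma le_kth_iff:
  assumes fin: "\<And>s. 0 < s \<Longrightarrow> finite {i. s < a i}" and k: "1 \<le> k" and s: "0 < s"
  shows "s \<le> kth k a \<longleftrightarrow> k \<le> card {i. s \<le> a i}"
proof
  assume "k \<le> card {i. s \<le> a i}"
  then obtain I where I: "I \<subseteq> {i. s \<le> a i}" "card I = k" "finite I" by (rule obtain_subset_with_card_n)
  then show "s \<le> kth k a" by (intro INF_le_kth[of I]) auto
next
  assume le: "s \<le> kth k a"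
  obtain r where r: "0 < r" "r < s" using s dense by blast
  \<comment> \<open>the largest value below \<open>s\<close>, or \<open>r\<close> if there is none above \<open>r\<close>: no term lies strictly between \<open>s'\<close> and \<open>s\<close>\<close>
  define s' where "s' = Max (insert r (a ` {i. r < a i \<and> a i < s}))"
  have finr: "finite {i. r < a i \<and> a i < s}" by (rule finite_subset[OF _ fin[OF r(1)]]) auto
  have "s' < s" unfolding s'_def using finr r by (subst Max_less_iff) auto
  then have "s' < kth k a" using le by simp
  then obtain I where I: "finite I" "card I = k" "\<forall>i\<in>I. s' < a i" unfolding less_kth_iff[OF k] by auto
  have "I \<subseteq> {i. s \<le> a i}"
  proof (intro subsetI CollectI, rule ccontr)
    fix i assume i: "i \<in> I" "\<not> s \<le> a i"
    have "r \<le> s'" unfolding s'_def using finr by simp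
    then have "i \<in> {i. r < a i \<and> a i < s}" using i I by (auto simp: not_le intro: order_le_less_trans)
    then have "a i \<le> s'" unfolding s'_def using finr by (intro Max_ge) auto
    then show False using i I by force
  qed
  moreover have "finite {i. s \<le> a i}"
    by (rule finite_subset[OF _ fin[OF r(1)]]) (use r in auto)
  ultimately show "k \<le> card {i. s \<le> a i}" using I card_mono by metis
qed

lemma less_kth_iff_card:
  assumes fin: "\<And>s. 0 < s \<Longrightarrow> finite {i. s < a i}" and k: "1 \<le> k" and s: "0 < s"
  shows "s < kth k a \<longleftrightarrow> k \<le> card {i. s < a i}"
proof
  assume "s < kth k a"
  then obtain I where "finite I" "card I = k" "I \<subseteq> {i. s < a i}" unfolding less_kth_iff[OF k] by auto
  then show "k \<le> card {i. s < a i}" using card_mono fin[OF s] by metis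
next
  assume "k \<le> card {i. s < a i}"
  then obtain I where I: "I \<subseteq> {i. s < a i}" "card I = k" "finite I" by (rule obtain_subset_with_card_n)
  then show "s < kth k a" unfolding less_kth_iff[OF k] by (intro exI[of _ I]) auto
qed

lemma kth_attained:
  assumes fin: "\<And>s. 0 < s \<Longrightarrow> finite {i. s < a i}" and k: "1 \<le> k" and pos: "0 < kth k a"
  shows "\<exists>i. a i = kth k a"
proof -
  let ?v = "kth k a"
  have "card {i. ?v < a i} < k" using less_kth_iff_card[OF fin k pos] by simp
  moreover have "k \<le> card {i. ?v \<le> a i}" using le_kth_iff[OF fin k pos] by simp
  ultimately have "{i. ?v < a i} \<noteq> {i. ?v \<le> a i}" by auto
  then show ?thesis by (auto simp: order_le_less)
qed

text \<open>A sequence with finitely many terms above every positive level has limit superior zero, so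
  that the \<open>k\<close>th largest term is attained or zero. The supremum formula is easier to handle than the
  definite description: it shows measurability and continuity at once.\<close>

lemma kmax_eq_kth:
  assumes fin: "\<And>s. 0 < s \<Longrightarrow> finite {i. s < a i}" and k: "1 \<le> k"
  shows "kmax k a = kth k a"
proof -
  have "limsup a \<le> s" if "0 < s" for s
  proof (rule Limsup_bounded)
    show "\<forall>\<^sub>F n in sequentially. a n \<le> s"
      using fin[OF that] by (simp add: cofinite_eq_sequentially[symmetric] eventually_cofinite not_le)
  qed
  then have "limsup a \<le> 0" by (rule dense_ge)
  then have L: "limsup a = 0" by simp
  define B where "B = {i. a i > 0}"
  show ?thesis
  proof (cases "finite B \<and> card B < k")
    case True
    have "\<not> 0 < kth k a"
    proof
      assume "0 < kth k a"
      then obtain I where "finite I" "card I = k" "\<forall>i\<in>I. 0 < a i" unfolding less_kth_iff[OF k] by auto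
      then have "I \<subseteq> B" by (auto simp: B_def)
      then show False using True \<open>card I = k\<close> card_mono by (metis leD)
    qed
    then show ?thesis using True L by (simp add: kmax_def Let_def B_def)
  next
    case False
    then have "\<exists>I. finite I \<and> card I = k \<and> I \<subseteq> B"
    proof (cases "finite B")
      case True
      with False have "k \<le> card B" by simp
      then show ?thesis using True by (metis obtain_subset_with_card_n)
    qed (rule infinite_arbitrarily_large)
    then obtain I where I: "finite I" "card I = k" "I \<subseteq> B" by blast
    then have pos: "0 < kth k a" unfolding less_kth_iff[OF k] B_def by auto
    let ?v = "kth k a"
    have gr: "{i \<in> B. a i > w} = {i. w < a i}" and ge: "0 < w \<Longrightarrow> {i \<in> B. a i \<ge> w} = {i. w \<le> a i}" for w
      by (auto simp: B_def intro: order_le_less_trans order_less_le_trans)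
    have "(THE v. v \<in> a ` B \<and> card {i \<in> B. a i > v} < k \<and> k \<le> card {i \<in> B. a i \<ge> v}) = ?v"
    proof (rule the_equality)
      have "card {i. ?v < a i} < k" using less_kth_iff_card[OF fin k pos] by simp
      moreover have "k \<le> card {i. ?v \<le> a i}" using le_kth_iff[OF fin k pos] by simp
      moreover obtain i where "a i = ?v" using kth_attained[OF fin k pos] by auto
      then have "i \<in> B" "?v = a i" using pos by (simp_all add: B_def)
      then have "?v \<in> a ` B" by (rule image_eqI[rotated])
      ultimately show "?v \<in> a ` B \<and> card {i \<in> B. a i > ?v} < k \<and> k \<le> card {i \<in> B. a i \<ge> ?v}"
        unfolding gr ge[OF pos] by blast
    next
      fix v assume v: "v \<in> a ` B \<and> card {i \<in> B. a i > v} < k \<and> k \<le> card {i \<in> B. a i \<ge> v}"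
      then have "0 < v" by (auto simp: B_def)
      have "card {i. v < a i} < k" "k \<le> card {i. v \<le> a i}"
        using v unfolding gr ge[OF \<open>0 < v\<close>] by blast+
      then have "\<not> v < ?v" "v \<le> ?v"
        using less_kth_iff_card[OF fin k \<open>0 < v\<close>] le_kth_iff[OF fin k \<open>0 < v\<close>] by simp_all
      then show "v = ?v" by simp
    qed
    moreover have "kmax k a = (THE v. v \<in> a ` B \<and> card {i \<in> B. a i > v} < k \<and> k \<le> card {i \<in> B. a i \<ge> v})"
      using False L unfolding kmax_def Let_def B_def by (simp only: if_False)
    ultimately show ?thesis by simp
  qed
qed

lemma kth_truncation_tendsto:
  assumes k: "1 \<le> k"
  shows "(\<lambda>n. kth k (\<lambda>i. if i < n then a i else 0)) \<longlonglongrightarrow> kth k a"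
proof -
  let ?t = "\<lambda>n. kth k (\<lambda>i. if i < n then a i else 0)"
  have inc: "incseq ?t"
  proof (rule incseq_SucI)
    show "?t n \<le> ?t (Suc n)" for n
      by (rule kth_mono_inj[OF k, where h = "\<lambda>i. i"]) auto
  qed
  have sup: "(SUP n. ?t n) = kth k a"
  proof (rule antisym)
    show "(SUP n. ?t n) \<le> kth k a"
    proof (rule SUP_least)
      show "?t n \<le> kth k a" for n
        by (rule kth_mono_inj[OF k, where h = "\<lambda>i. i"]) auto
    qed
    show "kth k a \<le> (SUP n. ?t n)"
    proof (rule ccontr)
      assume "\<not> kth k a \<le> (SUP n. ?t n)"
      then have "(SUP n. ?t n) < kth k a" by (simp only: not_le)
      then obtain I where I: "finite I" "card I = k" "\<forall>i\<in>I. (SUP n. ?t n) < a i"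
        unfolding less_kth_iff[OF k] by blast
      obtain n where "\<forall>i\<in>I. i < n" using I(1) finite_nat_set_iff_bounded by auto
      then have "\<forall>i\<in>I. (SUP n. ?t n) < (if i < n then a i else 0)" using I(3) by simp
      then have "(SUP n. ?t n) < ?t n"
        by (subst less_kth_iff[OF k]) (use I in blast)
      moreover have "?t n \<le> (SUP n. ?t n)" by (rule SUP_upper) simp
      ultimately show False by (simp only: not_le[symmetric])
    qed
  qed
  show ?thesis using LIMSEQ_SUP[OF inc] unfolding sup .
qed

lemma kth_sorted:
  fixes a :: "nat \<Rightarrow> ennreal"
  assumes bij: "bij_betw r {..<n} S" and zero: "\<And>i. i \<notin> S \<Longrightarrow> a i = 0"
    and anti: "\<And>i j. i \<le> j \<Longrightarrow> j < n \<Longrightarrow> a (r j) \<le> a (r i)" and k: "k < n"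
  shows "kth (Suc k) a = a (r k)"
proof (rule antisym)
  show "kth (Suc k) a \<le> a (r k)"
  proof (rule ccontr)
    assume "\<not> kth (Suc k) a \<le> a (r k)"
    then obtain I where I: "finite I" "card I = Suc k" "\<forall>i\<in>I. a (r k) < a i"
      by (auto simp: not_le less_kth_iff)
    have "I \<subseteq> r ` {..<k}"
    proof
      fix i assume "i \<in> I"
      then have "a (r k) < a i" using I by auto
      then have "i \<in> S" using zero by (metis not_less_zero)
      then obtain j where j: "j < n" "i = r j" using bij by (auto simp: bij_betw_def)
      have "j < k" using anti[of k j] \<open>a (r k) < a i\<close> j by (auto simp: not_le[symmetric])
      then show "i \<in> r ` {..<k}" using j by auto
    qed
    then have "card I \<le> k" using surj_card_le[of "{..<k}" I r] by simp
    then show False using I by simp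
  qed
  have "inj_on r {..k}" using bij k by (auto simp: bij_betw_def intro: inj_on_subset)
  then show "a (r k) \<le> kth (Suc k) a"
    using anti k by (intro INF_le_kth[of "r ` {..k}"]) (auto simp: card_image)
qed

lemma bij_betw_case_nat:
  assumes "bij_betw r {..<n} (S - {i})" "i \<in> S"
  shows "bij_betw (case_nat i r) {..<Suc n} S"
proof -
  have "inj_on (case_nat i r) {..<Suc n}"
    using assms by (auto simp: lessThan_Suc_eq_insert_0 bij_betw_def inj_on_def)
  moreover have "case_nat i r ` {..<Suc n} = S"
    using assms by (auto simp: lessThan_Suc_eq_insert_0 bij_betw_def image_image)
  ultimately show ?thesis by (simp add: bij_betw_def)
qed

lemma finite_has_maximum:
  fixes f :: "'i \<Rightarrow> 'a::linorder"
  assumes "finite S" "S \<noteq> {}"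
  shows "\<exists>i\<in>S. \<forall>l\<in>S. f l \<le> f i"
proof -
  have "Max (f ` S) \<in> f ` S" using assms by simp
  then obtain i where "i \<in> S" "Max (f ` S) = f i" by auto
  then show ?thesis using assms by (metis Max_ge finite_imageI imageI)
qed

text \<open>If \<open>a i\<close> and \<open>b j\<close> are the maxima of \<open>a\<close> and \<open>b\<close>, exchanging the values of \<open>b\<close> at \<open>i\<close> and \<open>j\<close> does
  not increase the sum, by the hypothesis on \<open>c\<close>. Afterwards the two maxima are matched at \<open>i\<close>, and the
  induction hypothesis takes care of the other indices.\<close>

lemma sorting_decreases_cost:
  fixes a b :: "'i \<Rightarrow> real" and c :: "real \<Rightarrow> real"
  assumes exch: "\<And>x x' y y'. x' \<le> x \<Longrightarrow> y' \<le> y \<Longrightarrow> c (x - y) + c (x' - y') \<le> c (x - y') + c (x' - y)"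
  assumes "finite S" "card S = n"
  shows "\<exists>r s. bij_betw r {..<n} S \<and> bij_betw s {..<n} S
    \<and> (\<forall>i j. i \<le> j \<longrightarrow> j < n \<longrightarrow> a (r j) \<le> a (r i))
    \<and> (\<forall>i j. i \<le> j \<longrightarrow> j < n \<longrightarrow> b (s j) \<le> b (s i))
    \<and> (\<Sum>k<n. c (a (r k) - b (s k))) \<le> (\<Sum>i\<in>S. c (a i - b i))"
  using assms(2,3)
proof (induction n arbitrary: S b)
  case 0
  then show ?case by (auto simp: bij_betw_def)
next
  case (Suc n)
  then have S: "finite S" "S \<noteq> {}" by auto
  obtain i where i: "i \<in> S" "\<And>l. l \<in> S \<Longrightarrow> a l \<le> a i"
    using finite_has_maximum[OF S, of a] by blast
  obtain j where j: "j \<in> S" "\<And>l. l \<in> S \<Longrightarrow> b l \<le> b j"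
    using finite_has_maximum[OF S, of b] by blast
  let ?t = "Transposition.transpose i j"
  define b' where "b' = b \<circ> ?t"
  have "finite (S - {i})" "card (S - {i}) = n" using Suc.prems i by auto
  from Suc.IH[OF this, of b'] obtain r s where
    r: "bij_betw r {..<n} (S - {i})" and s: "bij_betw s {..<n} (S - {i})"
    and ar: "\<And>l m. l \<le> m \<Longrightarrow> m < n \<Longrightarrow> a (r m) \<le> a (r l)"
    and bs: "\<And>l m. l \<le> m \<Longrightarrow> m < n \<Longrightarrow> b' (s m) \<le> b' (s l)"
    and le: "(\<Sum>k<n. c (a (r k) - b' (s k))) \<le> (\<Sum>l\<in>S - {i}. c (a l - b' l))"
    by blast
  \<comment> \<open>the maxima come first, and the exchange is undone in the ordering of \<open>b\<close>\<close>
  let ?r = "case_nat i r" and ?s = "case_nat j (?t \<circ> s)"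
  have "bij_betw ?t (S - {i}) (S - {j})"
    using i j by (intro bij_betw_byWitness[where f' = ?t]) (auto simp: Transposition.transpose_def)
  then have ts: "bij_betw (?t \<circ> s) {..<n} (S - {j})" using s by (rule bij_betw_trans[rotated])
  have sumS: "c (a i - b j) + (\<Sum>l\<in>S - {i}. c (a l - b' l)) \<le> (\<Sum>l\<in>S. c (a l - b l))"
  proof (cases "i = j")
    case True
    then show ?thesis using S i by (simp add: sum.remove[of S i] b'_def)
  next
    case False
    have eq: "(\<Sum>l\<in>S - {i} - {j}. c (a l - b' l)) = (\<Sum>l\<in>S - {i} - {j}. c (a l - b l))"
      by (rule sum.cong) (auto simp: b'_def Transposition.transpose_def)
    have "c (a i - b j) + c (a j - b i) \<le> c (a i - b i) + c (a j - b j)"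
      using exch[of "a j" "a i" "b i" "b j"] i j by auto
    then show ?thesis
      using S i j False eq sum.remove[of S i "\<lambda>l. c (a l - b l)"]
        sum.remove[of "S - {i}" j "\<lambda>l. c (a l - b l)"] sum.remove[of "S - {i}" j "\<lambda>l. c (a l - b' l)"]
      by (simp add: b'_def)
  qed
  have "bij_betw ?r {..<Suc n} S" by (rule bij_betw_case_nat[OF r i(1)])
  moreover have "bij_betw ?s {..<Suc n} S" by (rule bij_betw_case_nat[OF ts j(1)])
  moreover have "a (?r m) \<le> a (?r l)" if lm: "l \<le> m" "m < Suc n" for l m
  proof (cases l)
    case 0
    have "?r m \<in> S" using lm \<open>bij_betw ?r {..<Suc n} S\<close> by (auto simp: bij_betw_def)
    then show ?thesis using 0 i by simp
  next
    case (Suc l')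
    then obtain m' where "m = Suc m'" using lm by (cases m) auto
    then show ?thesis using Suc lm ar by simp
  qed
  moreover have "b (?s m) \<le> b (?s l)" if lm: "l \<le> m" "m < Suc n" for l m
  proof (cases l)
    case 0
    have "?s m \<in> S" using lm \<open>bij_betw ?s {..<Suc n} S\<close> by (auto simp: bij_betw_def)
    then show ?thesis using 0 j by simp
  next
    case (Suc l')
    then obtain m' where "m = Suc m'" using lm by (cases m) auto
    then show ?thesis using Suc lm bs[of l' m'] by (simp add: b'_def)
  qed
  moreover have "(\<Sum>k<Suc n. c (a (?r k) - b (?s k))) \<le> (\<Sum>l\<in>S. c (a l - b l))"
    using le sumS by (simp add: sum.lessThan_Suc_shift b'_def del: sum.lessThan_Suc)
  ultimately show ?case by blast
qed

section \<open>Sorting decreases the \<open>\<ell>\<^sup>p\<close> distance\<close>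

text \<open>Both \<open>x - y\<close> and \<open>x' - y'\<close> lie between \<open>x' - y\<close> and \<open>x - y'\<close>, and the two pairs have the same sum.
  So they are convex combinations of the latter two numbers with exchanged weights, and the claim is
  convexity of \<open>|\<cdot>|\<^sup>q\<close>.\<close>

lemma powr_exchange:
  fixes x x' y y' q :: real
  assumes q: "1 \<le> q" and le: "x' \<le> x" "y' \<le> y"
  shows "\<bar>x - y\<bar> powr q + \<bar>x' - y'\<bar> powr q \<le> \<bar>x - y'\<bar> powr q + \<bar>x' - y\<bar> powr q"
proof (cases "x = x' \<and> y = y'")
  case False
  define D where "D = (x - x') + (y - y')"
  have D: "0 < D" using le False by (auto simp: D_def)
  define u v where "u = (y - y') / D" and "v = (x - x') / D"
  have uv: "0 \<le> u" "0 \<le> v" "u + v = 1"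
    using D le by (auto simp: u_def v_def D_def add_divide_distrib[symmetric])
  have uD: "u * D = y - y'" "v * D = x - x'" using D by (auto simp: u_def v_def)
  have comb: "\<bar>w\<bar> powr q \<le> s * \<bar>x' - y\<bar> powr q + t * \<bar>x - y'\<bar> powr q"
    if "w = s * (x' - y) + t * (x - y')" "0 \<le> s" "0 \<le> t" "s + t = 1" for w s t
  proof -
    have "\<bar>w\<bar> \<le> s * \<bar>x' - y\<bar> + t * \<bar>x - y'\<bar>"
      unfolding that(1) using that(2,3) abs_triangle_ineq[of "s * (x' - y)" "t * (x - y')"]
      by (simp add: abs_mult)
    then have "\<bar>w\<bar> powr q \<le> (s * \<bar>x' - y\<bar> + t * \<bar>x - y'\<bar>) powr q"
      using q by (intro powr_mono2) auto
    also have "\<dots> \<le> s * \<bar>x' - y\<bar> powr q + t * \<bar>x - y'\<bar> powr q"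
      using that q by (intro powr_convex_combination) auto
    finally show ?thesis .
  qed
  have "x - y = u * (x' - y) + v * (x - y')"
  proof -
    have "u * (x' - y) + v * (x - y') = (u + v) * (x - y') - u * D"
      by (simp add: D_def algebra_simps)
    then show ?thesis using uv uD by simp
  qed
  from comb[OF this uv] have 1: "\<bar>x - y\<bar> powr q \<le> u * \<bar>x' - y\<bar> powr q + v * \<bar>x - y'\<bar> powr q" .
  have "x' - y' = v * (x' - y) + u * (x - y')"
  proof -
    have "v * (x' - y) + u * (x - y') = (u + v) * (x - y') - v * D"
      by (simp add: D_def algebra_simps)
    then show ?thesis using uv uD by simp
  qed
  from comb[OF this] uv have 2: "\<bar>x' - y'\<bar> powr q \<le> v * \<bar>x' - y\<bar> powr q + u * \<bar>x - y'\<bar> powr q" by simp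
  have "\<bar>x - y\<bar> powr q + \<bar>x' - y'\<bar> powr q
      \<le> (u + v) * \<bar>x' - y\<bar> powr q + (u + v) * \<bar>x - y'\<bar> powr q"
    using 1 2 by (simp add: distrib_right)
  then show ?thesis using uv by simp
qed simp

lemma kth_cost_finite:
  fixes a b :: "nat \<Rightarrow> real"
  assumes q: "1 \<le> q" and nn: "\<And>i. 0 \<le> a i" "\<And>i. 0 \<le> b i"
    and zero: "\<And>i. n \<le> i \<Longrightarrow> a i = 0" "\<And>i. n \<le> i \<Longrightarrow> b i = 0" and "K \<le> n"
  shows "(\<Sum>k<K. \<bar>enn2real (kth (Suc k) (\<lambda>i. ennreal (a i))) - enn2real (kth (Suc k) (\<lambda>i. ennreal (b i)))\<bar> powr q)
    \<le> (\<Sum>i<n. \<bar>a i - b i\<bar> powr q)"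
proof -
  obtain r s where rs: "bij_betw r {..<n} {..<n}" "bij_betw s {..<n} {..<n}"
    and anti: "\<And>i j. i \<le> j \<Longrightarrow> j < n \<Longrightarrow> a (r j) \<le> a (r i)"
      "\<And>i j. i \<le> j \<Longrightarrow> j < n \<Longrightarrow> b (s j) \<le> b (s i)"
    and le: "(\<Sum>k<n. \<bar>a (r k) - b (s k)\<bar> powr q) \<le> (\<Sum>i<n. \<bar>a i - b i\<bar> powr q)"
    using sorting_decreases_cost[of "\<lambda>x. \<bar>x\<bar> powr q" "{..<n}" n a b] powr_exchange[OF q] by fastforce
  have "kth (Suc k) (\<lambda>i. ennreal (a i)) = ennreal (a (r k))" if "k < n" for k
    by (rule kth_sorted[OF rs(1)]) (use that zero anti in \<open>auto intro: ennreal_leI\<close>)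
  moreover have "kth (Suc k) (\<lambda>i. ennreal (b i)) = ennreal (b (s k))" if "k < n" for k
    by (rule kth_sorted[OF rs(2)]) (use that zero anti in \<open>auto intro: ennreal_leI\<close>)
  ultimately have "(\<Sum>k<K. \<bar>enn2real (kth (Suc k) (\<lambda>i. ennreal (a i))) - enn2real (kth (Suc k) (\<lambda>i. ennreal (b i)))\<bar> powr q)
    = (\<Sum>k<K. \<bar>a (r k) - b (s k)\<bar> powr q)"
    using \<open>K \<le> n\<close> nn by (intro sum.cong) auto
  also have "\<dots> \<le> (\<Sum>k<n. \<bar>a (r k) - b (s k)\<bar> powr q)"
    using \<open>K \<le> n\<close> by (intro sum_mono2) auto
  finally show ?thesis using le by simp
qed

lemma enn2real_kth_truncation_tendsto:
  fixes a :: "nat \<Rightarrow> real"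
  assumes "1 \<le> k" "kth k (\<lambda>i. ennreal (a i)) < \<infinity>"
  shows "(\<lambda>n. enn2real (kth k (\<lambda>i. ennreal (if i < n then a i else 0))))
    \<longlonglongrightarrow> enn2real (kth k (\<lambda>i. ennreal (a i)))"
proof (rule tendsto_enn2real)
  have "(\<lambda>i. ennreal (if i < n then a i else 0)) = (\<lambda>i. if i < n then ennreal (a i) else 0)" for n
    by auto
  then show "(\<lambda>n. kth k (\<lambda>i. ennreal (if i < n then a i else 0)))
      \<longlonglongrightarrow> ennreal (enn2real (kth k (\<lambda>i. ennreal (a i))))"
    using kth_truncation_tendsto[OF assms(1), of "\<lambda>i. ennreal (a i)"] assms(2) by simp
qed simp

text \<open>Each partial sum on the left is a limit of partial sums for truncated sequences, where the
  finite case applies with a bound that does not depend on the truncation.\<close>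

lemma kth_cost:
  fixes a b :: "nat \<Rightarrow> real"
  assumes q: "1 \<le> q" and nn: "\<And>i. 0 \<le> a i" "\<And>i. 0 \<le> b i"
    and fin: "\<And>k. 1 \<le> k \<Longrightarrow> kth k (\<lambda>i. ennreal (a i)) < \<infinity>" "\<And>k. 1 \<le> k \<Longrightarrow> kth k (\<lambda>i. ennreal (b i)) < \<infinity>"
  shows "(\<integral>\<^sup>+ k. ennreal (\<bar>enn2real (kth k (\<lambda>i. ennreal (a i))) - enn2real (kth k (\<lambda>i. ennreal (b i)))\<bar> powr q) \<partial>count_space {1..})
    \<le> (\<integral>\<^sup>+ i. ennreal (\<bar>a i - b i\<bar> powr q) \<partial>count_space UNIV)" (is "?L \<le> ?R")
proof -
  let ?d = "\<lambda>k. \<bar>enn2real (kth k (\<lambda>i. ennreal (a i))) - enn2real (kth k (\<lambda>i. ennreal (b i)))\<bar> powr q"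
  let ?dn = "\<lambda>n k. \<bar>enn2real (kth k (\<lambda>i. ennreal (if i < n then a i else 0)))
    - enn2real (kth k (\<lambda>i. ennreal (if i < n then b i else 0)))\<bar> powr q"
  have bij: "bij_betw Suc UNIV {1..}"
    by (intro bij_betw_byWitness[where f' = "\<lambda>n. n - 1"]) auto
  have "?L = (\<integral>\<^sup>+ k. ennreal (?d (Suc k)) \<partial>count_space UNIV)"
    by (rule nn_integral_bij_count_space[OF bij, symmetric])
  also have "\<dots> = (\<Sum>k. ennreal (?d (Suc k)))" by (rule nn_integral_count_space_nat)
  also have "\<dots> \<le> ?R"
  proof (rule suminf_le_const[OF summableI])
    fix K
    have "(\<lambda>n. ennreal (\<Sum>k<K. ?dn n (Suc k))) \<longlonglongrightarrow> ennreal (\<Sum>k<K. ?d (Suc k))"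
      using q by (intro tendsto_ennrealI tendsto_sum tendsto_powr' tendsto_rabs tendsto_diff tendsto_const
        enn2real_kth_truncation_tendsto fin) auto
    moreover have "ennreal (\<Sum>k<K. ?dn n (Suc k)) \<le> ?R" if "K \<le> n" for n
    proof -
      have "(\<Sum>k<K. ?dn n (Suc k)) \<le> (\<Sum>i<n. \<bar>(if i < n then a i else 0) - (if i < n then b i else 0)\<bar> powr q)"
        by (intro kth_cost_finite q that) (use nn in auto)
      also have "\<dots> = (\<Sum>i<n. \<bar>a i - b i\<bar> powr q)" by (rule sum.cong) auto
      finally have "ennreal (\<Sum>k<K. ?dn n (Suc k)) \<le> (\<Sum>i<n. ennreal (\<bar>a i - b i\<bar> powr q))"
        by (simp add: ennreal_leI)
      also have "\<dots> \<le> (\<Sum>i. ennreal (\<bar>a i - b i\<bar> powr q))" by (rule sum_le_suminf) auto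
      also have "\<dots> = ?R" by (rule nn_integral_count_space_nat[symmetric])
      finally show ?thesis .
    qed
    ultimately have "ennreal (\<Sum>k<K. ?d (Suc k)) \<le> ?R"
      by (intro LIMSEQ_le_const2) auto
    then show "(\<Sum>k<K. ennreal (?d (Suc k))) \<le> ?R" by simp
  qed
  finally show ?thesis .
qed

text \<open>The counterpart of \<open>kth_cost\<close> for the supremum norm. It also shows that landscapes inherit the
  Lipschitz constant of the triangle functions.\<close>

lemma kth_lipschitz:
  fixes a b :: "nat \<Rightarrow> real"
  assumes k: "1 \<le> k" and c: "\<And>i. \<bar>a i - b i\<bar> \<le> c"
    and nn: "\<And>i. 0 \<le> a i" "\<And>i. 0 \<le> b i"
    and fin: "kth k (\<lambda>i. ennreal (a i)) < \<infinity>" "kth k (\<lambda>i. ennreal (b i)) < \<infinity>"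
  shows "\<bar>enn2real (kth k (\<lambda>i. ennreal (a i))) - enn2real (kth k (\<lambda>i. ennreal (b i)))\<bar> \<le> c"
proof -
  have c0: "0 \<le> c" using c[of 0] by linarith
  have one: "enn2real (kth k (\<lambda>i. ennreal (u i))) \<le> enn2real (kth k (\<lambda>i. ennreal (v i))) + c"
    if "\<And>i. u i \<le> v i + c" "\<And>i. 0 \<le> v i" "kth k (\<lambda>i. ennreal (v i)) < \<infinity>" for u v :: "nat \<Rightarrow> real"
  proof -
    have "kth k (\<lambda>i. ennreal (u i)) \<le> kth k (\<lambda>i. ennreal (v i)) + ennreal c"
      using that c0 by (intro kth_le_add k) (simp add: ennreal_plus[symmetric] ennreal_leI del: ennreal_plus)
    then have "enn2real (kth k (\<lambda>i. ennreal (u i))) \<le> enn2real (kth k (\<lambda>i. ennreal (v i)) + ennreal c)"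
      using that(3) by (intro enn2real_mono) auto
    then show ?thesis using that(3) c0 by (simp add: enn2real_plus)
  qed
  have "a i \<le> b i + c" "b i \<le> a i + c" for i using c[of i] by linarith+
  then show ?thesis using one[of a b] one[of b a] nn fin by fastforce
qed

section \<open>Triangle functions and distances between points\<close>

lemma triangle_nonneg: "0 \<le> triangle x t"
  by (cases x) (auto simp: infdist_nonneg)

lemma triangle_lipschitz: "\<bar>triangle x t - triangle x t'\<bar> \<le> \<bar>t - t'\<bar>"
proof (cases x)
  case (Some z)
  obtain b d where "z = (b, d)" by (cases z)
  then show ?thesis using Some infdist_triangle_abs[of t "- {b<..<d}" t'] by (simp add: dist_real_def)
qed simp

lemma triangle_measurable [measurable]: "triangle x \<in> borel_measurable borel"
proof (rule borel_measurable_continuous_onI)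
  show "continuous_on UNIV (triangle x)"
  proof (cases x)
    case (Some z)
    obtain b d where z: "z = (b, d)" by (cases z)
    have "continuous_on UNIV (\<lambda>t. infdist t (- {b<..<d}))" by (intro continuous_intros)
    then show ?thesis using Some z by simp
  next
    case None
    then have "triangle x = (\<lambda>t. 0)" by auto
    then show ?thesis by simp
  qed
qed

text \<open>The superlevel sets of a triangle function, seen from the point \<open>(b, d)\<close>: for fixed \<open>t\<close> and \<open>s\<close>, the
  points with value at least \<open>s\<close> at \<open>t\<close> form a closed quadrant.\<close>

lemma le_triangle_iff:
  assumes "0 < s"
  shows "s \<le> triangle (Some (b, d)) t \<longleftrightarrow> b \<le> t - s \<and> t + s \<le> d"
proof
  assume le: "s \<le> triangle (Some (b, d)) t"
  have out: "s \<le> \<bar>t - a\<bar>" if "a \<le> b \<or> d \<le> a" for a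
    using infdist_le[of a "- {b<..<d}" t] that le by (auto simp: dist_real_def)
  have "b < t" "t < d" using out[of t] assms by (auto simp: not_le[symmetric])
  then show "b \<le> t - s \<and> t + s \<le> d" using out[of b] out[of d] by auto
next
  assume bd: "b \<le> t - s \<and> t + s \<le> d"
  have "- {b<..<d} \<noteq> {}" by (metis ComplI empty_iff greaterThanLessThan_iff less_irrefl)
  then show "s \<le> triangle (Some (b, d)) t"
    using bd assms by (auto simp: infdist_notempty dist_real_def intro!: cINF_greatest)
qed

lemma triangle_bounds:
  "\<exists>C R. \<forall>t. \<bar>triangle x t\<bar> \<le> C \<and> (R < \<bar>t\<bar> \<longrightarrow> triangle x t = 0)"
proof (cases x)
  case (Some z)
  obtain b d where z: "z = (b, d)" by (cases z)
  have pos: "b + triangle x t \<le> t \<and> t + triangle x t \<le> d" if "triangle x t \<noteq> 0" for t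
    using le_triangle_iff[of "triangle x t" b d t] that triangle_nonneg[of x t] Some z by auto
  have "\<bar>triangle x t\<bar> \<le> \<bar>d - b\<bar>" for t
    using pos[of t] triangle_nonneg[of x t] by (cases "triangle x t = 0") auto
  moreover have "triangle x t = 0" if "\<bar>b\<bar> + \<bar>d\<bar> < \<bar>t\<bar>" for t
    using pos[of t] triangle_nonneg[of x t] that by (cases "triangle x t = 0") auto
  ultimately show ?thesis by blast
next
  case None
  then show ?thesis by auto
qed

lemma Lp_norm_bounded_support_finite:
  fixes f :: "real \<Rightarrow> real"
  assumes p: "1 \<le> p" and [measurable]: "f \<in> borel_measurable borel"
    and C: "\<And>t. \<bar>f t\<bar> \<le> C" and R: "\<And>t. R < \<bar>t\<bar> \<Longrightarrow> f t = 0"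
  shows "Lp_norm p lborel f < \<infinity>"
proof (cases "p = \<infinity>")
  case True
  have "0 \<le> C" using C[of 0] by linarith
  then have "Lp_norm p lborel f \<le> ennreal C" using True C by (subst Lp_norm_top_le_iff) auto
  then show ?thesis by (auto simp: less_top[symmetric] top_unique)
next
  case False
  define q where "q = enn2real p"
  have q: "1 \<le> q" using enn2real_ge_1[OF p False] by (simp add: q_def)
  have "(\<integral>\<^sup>+ t. ennreal (\<bar>f t\<bar> powr q) \<partial>lborel) \<le> (\<integral>\<^sup>+ t. ennreal (C powr q) * indicator {-R..R} t \<partial>lborel)"
  proof (rule nn_integral_mono)
    fix t
    show "ennreal (\<bar>f t\<bar> powr q) \<le> ennreal (C powr q) * indicator {-R..R} t"
      proof (cases "R < \<bar>t\<bar>")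
      case False
      then have "t \<in> {-R..R}" by auto
      then show ?thesis using C[of t] q by (auto intro!: ennreal_leI powr_mono2)
    qed (simp add: R)
  qed
  also have "\<dots> = ennreal (C powr q) * emeasure lborel {-R..R}" by (simp add: nn_integral_cmult)
  also have "\<dots> < \<infinity>" by (auto simp: ennreal_mult_less_top emeasure_lborel_Icc_eq)
  finally have "(\<integral>\<^sup>+ t. ennreal (\<bar>f t\<bar> powr enn2real p) \<partial>lborel) \<noteq> \<infinity>" by (simp add: q_def)
  then show ?thesis using False by (simp add: Lp_norm_def ennreal_powr_def)
qed

text \<open>Without finiteness of the norm, the conversion to a real number in the definition of
  the distance would turn infinity into zero.\<close>

lemma ennreal_pt_dist:
  assumes "1 \<le> p"
  shows "ennreal (pt_dist p x y) = Lp_norm p lborel (\<lambda>t. triangle x t - triangle y t)"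
proof -
  obtain C R where 1: "\<And>t. \<bar>triangle x t\<bar> \<le> C" "\<And>t. R < \<bar>t\<bar> \<Longrightarrow> triangle x t = 0"
    using triangle_bounds[of x] by blast
  obtain C' R' where 2: "\<And>t. \<bar>triangle y t\<bar> \<le> C'" "\<And>t. R' < \<bar>t\<bar> \<Longrightarrow> triangle y t = 0"
    using triangle_bounds[of y] by blast
  have "Lp_norm p lborel (\<lambda>t. triangle x t - triangle y t) < \<infinity>"
  proof (rule Lp_norm_bounded_support_finite[OF assms])
    show "\<bar>triangle x t - triangle y t\<bar> \<le> C + C'" for t using 1(1)[of t] 2(1)[of t] by linarith
    show "triangle x t - triangle y t = 0" if "max R R' < \<bar>t\<bar>" for t using 1(2)[of t] 2(2)[of t] that by auto
  qed auto
  then show ?thesis by (simp add: pt_dist_def)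
qed

lemma pt_dist_nonneg: "0 \<le> pt_dist p x y"
  by (simp add: pt_dist_def)

lemma pt_dist_refl: "1 \<le> p \<Longrightarrow> pt_dist p x x = 0"
  by (simp add: pt_dist_def Lp_norm_zero)

lemma pt_dist_commute: "pt_dist p x y = pt_dist p y x"
  by (simp add: pt_dist_def Lp_norm_def abs_minus_commute)

lemma pt_dist_triangle:
  assumes "1 \<le> p"
  shows "pt_dist p x z \<le> pt_dist p x y + pt_dist p y z"
proof -
  have "ennreal (pt_dist p x z) = Lp_norm p lborel (\<lambda>t. (triangle x t - triangle y t) + (triangle y t - triangle z t))"
    by (simp add: ennreal_pt_dist assms)
  also have "\<dots> \<le> ennreal (pt_dist p x y) + ennreal (pt_dist p y z)"
    unfolding ennreal_pt_dist[OF assms] by (rule Lp_norm_add_le[OF assms]) auto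
  finally show ?thesis
    by (simp add: ennreal_plus[symmetric] pt_dist_nonneg del: ennreal_plus)
qed

text \<open>A triangle function that reaches the value \<open>s\<close> stays above \<open>s / 2\<close> on an interval of length \<open>s\<close>,
  as it is 1-Lipschitz. So a small distance to the diagonal forces a low triangle.\<close>

lemma pt_dist_None_lower_bound:
  assumes p: "1 \<le> p" and s: "0 < s"
  shows "\<exists>\<delta>>0. \<forall>x t. s \<le> triangle x t \<longrightarrow> \<delta> \<le> pt_dist p x None"
proof -
  have mono: "Lp_norm p lborel (\<lambda>u. s/2 * indicator {t - s/2..t + s/2} u) \<le> ennreal (pt_dist p x None)"
    if "s \<le> triangle x t" for x t
    unfolding ennreal_pt_dist[OF p]
  proof (rule Lp_norm_mono_AE[OF p])
    show "AE u in lborel. \<bar>s/2 * indicator {t - s/2..t + s/2} u\<bar> \<le> \<bar>triangle x u - triangle None u\<bar>"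
    proof (rule AE_I2)
      fix u
      show "\<bar>s/2 * indicator {t - s/2..t + s/2} u\<bar> \<le> \<bar>triangle x u - triangle None u\<bar>"
        using that triangle_lipschitz[of x t u] s by (auto split: split_indicator)
    qed
  qed auto
  show ?thesis
  proof (cases "p = \<infinity>")
    case True
    have "s/2 \<le> pt_dist p x None" if t: "s \<le> triangle x t" for x t
    proof (rule ccontr)
      assume less: "\<not> s/2 \<le> pt_dist p x None"
      have "AE u in lborel. \<bar>s/2 * indicator {t - s/2..t + s/2} u\<bar> \<le> pt_dist p x None"
        by (subst Lp_norm_top_le_iff[OF True, symmetric]) (use mono[OF t] pt_dist_nonneg in auto)
      then have "AE u in lborel. u \<notin> {t - s/2..t + s/2}"
        by eventually_elim (use less s in \<open>auto split: split_indicator_asm\<close>)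
      then have "{t - s/2..t + s/2} \<in> null_sets lborel" by (subst AE_iff_null_sets) auto
      then show False using s by (auto simp: null_sets_def)
    qed
    then show ?thesis using s by (intro exI[of _ "s/2"]) auto
  next
    case False
    define q where "q = enn2real p"
    have q: "1 \<le> q" using enn2real_ge_1[OF p False] by (simp add: q_def)
    have "((s/2) powr q * s) powr (1/q) \<le> pt_dist p x None" if t: "s \<le> triangle x t" for x t
    proof -
      have "ennreal ((s/2) powr q * s) = ennreal ((s/2) powr q) * emeasure lborel {t - s/2..t + s/2}"
        using s by (simp add: ennreal_mult)
      also have "\<dots> = (\<integral>\<^sup>+ u. ennreal ((s/2) powr q) * indicator {t - s/2..t + s/2} u \<partial>lborel)"
        by (simp add: nn_integral_cmult)
      also have "\<dots> = (\<integral>\<^sup>+ u. ennreal (\<bar>s/2 * indicator {t - s/2..t + s/2} u\<bar> powr q) \<partial>lborel)"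
        using s by (intro nn_integral_cong) (auto split: split_indicator)
      also have "\<dots> \<le> ennreal (pt_dist p x None powr q)"
        using mono[OF t] by (subst (asm) Lp_norm_le_iff[OF p False]) (auto simp: pt_dist_nonneg q_def)
      finally have "(s/2) powr q * s \<le> pt_dist p x None powr q" by simp
      then have "((s/2) powr q * s) powr (1/q) \<le> (pt_dist p x None powr q) powr (1/q)"
        using q s by (intro powr_mono2) auto
      then show ?thesis using q pt_dist_nonneg[of p x None] by (simp add: powr_powr)
    qed
    then show ?thesis using s by (intro exI[of _ "((s/2) powr q * s) powr (1/q)"]) auto
  qed
qed

section \<open>The Wasserstein distance as an infimum over couplings\<close>

text \<open>Two families with equally large fibres differ by a reordering. All reorderings of listings
  below are obtained from this.\<close>

lemma glue_fibre_bijections: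
  assumes "\<And>z. \<exists>h. bij_betw h {i \<in> A. f i = z} {j \<in> B. g j = z}"
  shows "\<exists>h. bij_betw h A B \<and> (\<forall>i\<in>A. g (h i) = f i)"
proof -
  obtain h where h: "\<And>z. bij_betw (h z) {i \<in> A. f i = z} {j \<in> B. g j = z}" using assms by metis
  define k where "k i = h (f i) i" for i
  have k: "k i \<in> B \<and> g (k i) = f i" if "i \<in> A" for i
    using h[of "f i"] that by (auto simp: k_def bij_betw_def)
  have "inj_on k A"
  proof (rule inj_onI)
    fix i j assume ij: "i \<in> A" "j \<in> A" "k i = k j"
    then have "f i = f j" using k by metis
    then show "i = j" using h[of "f i"] ij by (auto simp: k_def bij_betw_def inj_on_def)
  qed
  moreover have "k ` A = B"
  proof
    show "k ` A \<subseteq> B" using k by auto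
    show "B \<subseteq> k ` A"
    proof
      fix j assume "j \<in> B"
      then have "j \<in> h (g j) ` {i \<in> A. f i = g j}" using h[of "g j"] by (auto simp: bij_betw_def)
      then obtain i where "i \<in> A" "f i = g j" "j = h (g j) i" by auto
      then show "j \<in> k ` A" by (auto simp: k_def image_iff intro!: bexI[of _ i])
    qed
  qed
  ultimately show ?thesis using k by (auto simp: bij_betw_def)
qed

lemma infinite_nat_bij:
  fixes A B :: "nat set"
  assumes "infinite A" "infinite B"
  shows "\<exists>h. bij_betw h A B"
  using bij_betw_trans[OF bij_betw_inv_into[OF bij_enumerate[OF assms(1)]] bij_enumerate[OF assms(2)]] by blast

lemma is_sum_fibre_bij:
  assumes "is_sum \<alpha> x" "is_sum \<alpha> y"
  shows "\<exists>h. bij_betw h {i. x i = Some z} {i. y i = Some z}"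
proof (cases "finite {i. x i = Some z}")
  case True
  then have "finite {i. y i = Some z}" "card {i. x i = Some z} = card {i. y i = Some z}"
    using assms unfolding is_sum_def by (metis enat.distinct(1), metis enat.distinct(1) enat.inject)
  then show ?thesis using True finite_same_card_bij by blast
next
  case False
  then have "infinite {i. y i = Some z}"
    using assms unfolding is_sum_def by (metis enat.distinct(1))
  then show ?thesis using False infinite_nat_bij by blast
qed

lemma is_sum_transfer:
  assumes "is_sum \<alpha> x" "range y \<subseteq> points" "\<And>z. \<exists>h. bij_betw h {i. x i = Some z} {i. y i = Some z}"
  shows "is_sum \<alpha> y"
  unfolding is_sum_def
proof (intro conjI allI assms(2))
  fix z
  obtain h where "bij_betw h {i. x i = Some z} {i. y i = Some z}" using assms(3) by blast
  then have "finite {i. x i = Some z} = finite {i. y i = Some z}" "card {i. x i = Some z} = card {i. y i = Some z}"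
    by (rule bij_betw_finite, rule bij_betw_same_card)
  then show "\<alpha> z = (if finite {i. y i = Some z} then enat (card {i. y i = Some z}) else \<infinity>)"
    using assms(1) by (simp only: is_sum_def)
qed

lemma is_sum_support_bij:
  assumes "is_sum \<alpha> x" "is_sum \<alpha> y"
  shows "\<exists>h. bij_betw h {i. x i \<noteq> None} {i. y i \<noteq> None} \<and> (\<forall>i. x i \<noteq> None \<longrightarrow> y (h i) = x i)"
proof -
  have "\<exists>h. bij_betw h {i \<in> {i. x i \<noteq> None}. x i = w} {j \<in> {j. y j \<noteq> None}. y j = w}" for w
  proof (cases w)
    case (Some z)
    have eq: "{i \<in> {i. x i \<noteq> None}. x i = Some z} = {i. x i = Some z}" for x :: "nat \<Rightarrow> point" by auto
    show ?thesis unfolding Some eq by (rule is_sum_fibre_bij[OF assms])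
  qed (auto simp: bij_betw_def)
  from glue_fibre_bijections[where f = x and g = y, OF this] show ?thesis by auto
qed

lemma is_sum_reindex:
  assumes "is_sum \<alpha> x" "bij s"
  shows "is_sum \<alpha> (\<lambda>i. x (s i))"
proof (rule is_sum_transfer[OF assms(1)])
  show "range (\<lambda>i. x (s i)) \<subseteq> points" using assms(1) by (auto simp: is_sum_def)
  have "bij_betw s {i. x (s i) = Some z} {i. x i = Some z}" for z
    using assms(2) by (intro bij_betw_byWitness[where f' = "inv s"])
      (auto simp: bij_is_inj bij_is_surj surj_f_inv_f)
  then show "\<exists>h. bij_betw h {i. x i = Some z} {i. x (s i) = Some z}" for z
    using bij_betw_inv_into by blast
qed

definition pad :: "(nat \<Rightarrow> point) \<Rightarrow> nat \<Rightarrow> point" where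
  "pad x i = (if even i then x (i div 2) else None)"

lemma is_sum_pad:
  assumes "is_sum \<alpha> x"
  shows "is_sum \<alpha> (pad x)"
proof (rule is_sum_transfer[OF assms])
  have "None \<in> points" by (simp add: points_def)
  then show "range (pad x) \<subseteq> points" using assms by (auto simp: is_sum_def pad_def)
  have "bij_betw (\<lambda>i. 2 * i) {i. x i = Some z} {i. pad x i = Some z}" for z
    by (intro bij_betw_byWitness[where f' = "\<lambda>i. i div 2"]) (auto simp: pad_def split: if_splits)
  then show "\<exists>h. bij_betw h {i. x i = Some z} {i. pad x i = Some z}" for z by blast
qed

text \<open>Two listings of a diagram may contain the basepoint differently often, so one need not be a
  reordering of the other. After padding both contain it infinitely often.\<close>

lemma pad_bij:
  assumes "is_sum \<alpha> x" "is_sum \<alpha> y"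
  shows "\<exists>h. bij h \<and> (\<forall>i. pad y (h i) = pad x i)"
proof -
  have "\<exists>h. bij_betw h {i \<in> UNIV. pad x i = w} {j \<in> UNIV. pad y j = w}" for w
  proof (cases w)
    case None
    have "infinite {i. pad x i = None}" for x
    proof (rule infinite_super)
      show "range (\<lambda>i. 2 * i + 1) \<subseteq> {i. pad x i = None}" by (auto simp: pad_def)
      show "infinite (range (\<lambda>i::nat. 2 * i + 1))" by (intro range_inj_infinite injI) simp
    qed
    then show ?thesis using infinite_nat_bij None by simp
  next
    case (Some z)
    then show ?thesis using is_sum_fibre_bij[OF is_sum_pad[OF assms(1)] is_sum_pad[OF assms(2)]] by simp
  qed
  from glue_fibre_bijections[where f = "pad x" and g = "pad y", OF this] show ?thesis by auto
qed

definition cost :: "ennreal \<Rightarrow> (nat \<Rightarrow> point) \<Rightarrow> (nat \<Rightarrow> point) \<Rightarrow> ennreal" where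
  "cost p u v = Lp_norm p (count_space UNIV) (\<lambda>i. pt_dist p (u i) (v i))"

definition coupling_dist :: "ennreal \<Rightarrow> diagram \<Rightarrow> diagram \<Rightarrow> ennreal" where
  "coupling_dist p \<alpha> \<beta> = (INF (u, v)\<in>{(u, v). is_sum \<alpha> u \<and> is_sum \<beta> v}. cost p u v)"

lemma coupling_dist_le_cost:
  "is_sum \<alpha> u \<Longrightarrow> is_sum \<beta> v \<Longrightarrow> coupling_dist p \<alpha> \<beta> \<le> cost p u v"
  unfolding coupling_dist_def by (rule INF_lower2[of "(u, v)"]) auto

lemma cost_pad_le:
  assumes "1 \<le> p"
  shows "cost p (pad u) (pad v) \<le> cost p u v"
  unfolding cost_def
proof (rule Lp_norm_count_space_inj_le[OF assms, where h = "\<lambda>i. i div 2"])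
  have "{i \<in> UNIV. pt_dist p (pad u i) (pad v i) \<noteq> 0} \<subseteq> {i. even i}"
    using assms by (auto simp: pad_def pt_dist_refl split: if_splits)
  moreover have "inj_on (\<lambda>i::nat. i div 2) {i. even i}" by (auto simp: inj_on_def)
  ultimately show "inj_on (\<lambda>i. i div 2) {i \<in> UNIV. pt_dist p (pad u i) (pad v i) \<noteq> 0}"
    by (rule inj_on_subset[rotated])
qed (use assms in \<open>auto simp: pad_def pt_dist_refl split: if_splits\<close>)

lemma cost_reindex_le:
  assumes "1 \<le> p" "bij s"
  shows "cost p (\<lambda>i. u (s i)) (\<lambda>i. v (s i)) \<le> cost p u v"
  unfolding cost_def
proof (rule Lp_norm_count_space_inj_le[OF assms(1), where h = s])
  show "inj_on s {i \<in> UNIV. pt_dist p (u (s i)) (v (s i)) \<noteq> 0}"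
    by (rule inj_on_subset[OF bij_is_inj[OF assms(2)]]) simp
qed auto

lemma cost_commute: "cost p u v = cost p v u"
  by (simp add: cost_def pt_dist_commute)

text \<open>Gluing of couplings. The two listings of the middle diagram become equal after padding and
  reordering, and then the triangle inequality for points applies term by term.\<close>

lemma coupling_dist_le_cost_add:
  assumes p: "1 \<le> p" and "is_sum \<alpha> u" "is_sum \<beta> v" "is_sum \<beta> v'" "is_sum \<gamma> w"
  shows "coupling_dist p \<alpha> \<gamma> \<le> cost p u v + cost p v' w"
proof -
  obtain h where h: "bij h" "\<And>i. pad v' (h i) = pad v i" using pad_bij assms by blast
  have "coupling_dist p \<alpha> \<gamma> \<le> cost p (pad u) (\<lambda>i. pad w (h i))"
    by (rule coupling_dist_le_cost[OF is_sum_pad[OF assms(2)] is_sum_reindex[OF is_sum_pad[OF assms(5)] h(1)]])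
  also have "\<dots> \<le> Lp_norm p (count_space UNIV)
      (\<lambda>i. pt_dist p (pad u i) (pad v i) + pt_dist p (pad v' (h i)) (pad w (h i)))"
    unfolding cost_def
  proof (rule Lp_norm_mono_AE[OF p])
    show "AE i in count_space UNIV. \<bar>pt_dist p (pad u i) (pad w (h i))\<bar>
        \<le> \<bar>pt_dist p (pad u i) (pad v i) + pt_dist p (pad v' (h i)) (pad w (h i))\<bar>"
      using pt_dist_triangle[OF p] by (simp add: h pt_dist_nonneg)
  qed auto
  also have "\<dots> \<le> cost p (pad u) (pad v) + cost p (\<lambda>i. pad v' (h i)) (\<lambda>i. pad w (h i))"
    unfolding cost_def by (rule Lp_norm_add_le[OF p]) auto
  also have "\<dots> \<le> cost p u v + cost p v' w"
    by (rule add_mono[OF cost_pad_le[OF p] order_trans[OF cost_reindex_le[OF p h(1)] cost_pad_le[OF p]]])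
  finally show ?thesis .
qed

lemma ennreal_le_add_Inf:
  fixes d :: ennreal
  assumes "\<And>a b. a \<in> A \<Longrightarrow> b \<in> B \<Longrightarrow> d \<le> a + b"
  shows "d \<le> Inf A + Inf B"
proof (rule ennreal_le_epsilon)
  fix e :: real assume e: "0 < e" and fin: "Inf A + Inf B < top"
  have "x < x + ennreal (e/2)" if "x < top" for x
    using that e by (cases x) (auto simp: ennreal_plus[symmetric] ennreal_less_iff simp del: ennreal_plus)
  moreover have "Inf A < top" "Inf B < top" using fin by auto
  ultimately have "Inf A < Inf A + ennreal (e/2)" "Inf B < Inf B + ennreal (e/2)" by blast+
  then obtain a b where "a \<in> A" "a < Inf A + ennreal (e/2)" "b \<in> B" "b < Inf B + ennreal (e/2)"
    unfolding Inf_less_iff by blast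
  then have "d \<le> (Inf A + ennreal (e/2)) + (Inf B + ennreal (e/2))"
    using assms[of a b] by (meson add_mono less_imp_le order_trans)
  also have "\<dots> = Inf A + Inf B + (ennreal (e/2) + ennreal (e/2))" by (simp add: ac_simps)
  also have "ennreal (e/2) + ennreal (e/2) = ennreal e" using e by (simp add: ennreal_plus[symmetric] del: ennreal_plus)
  finally show "d \<le> Inf A + Inf B + ennreal e" .
qed

lemma coupling_dist_triangle:
  assumes "1 \<le> p"
  shows "coupling_dist p \<alpha> \<gamma> \<le> coupling_dist p \<alpha> \<beta> + coupling_dist p \<beta> \<gamma>"
  unfolding coupling_dist_def[of p \<alpha> \<beta>] coupling_dist_def[of p \<beta> \<gamma>]
  by (rule ennreal_le_add_Inf) (auto intro!: coupling_dist_le_cost_add[OF assms])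

definition trunc :: "nat \<Rightarrow> (nat \<Rightarrow> point) \<Rightarrow> nat \<Rightarrow> point" where
  "trunc n x i = (if i < n then x i else None)"

definition diagram_of :: "(nat \<Rightarrow> point) \<Rightarrow> diagram" where
  "diagram_of x z = (if finite {i. x i = Some z} then enat (card {i. x i = Some z}) else \<infinity>)"

lemma is_sum_diagram_of: "range x \<subseteq> points \<Longrightarrow> is_sum (diagram_of x) x"
  by (simp add: is_sum_def diagram_of_def)

lemma is_sum_trunc: "is_sum \<alpha> x \<Longrightarrow> is_sum (diagram_of (trunc n x)) (trunc n x)"
proof (rule is_sum_diagram_of)
  assume "is_sum \<alpha> x"
  moreover have "None \<in> points" by (simp add: points_def)
  ultimately show "range (trunc n x) \<subseteq> points" by (auto simp: is_sum_def trunc_def)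
qed

text \<open>Coupling a diagram with its truncation in the identical way leaves exactly the tail
  unmatched.\<close>

lemma cost_trunc:
  assumes "1 \<le> p"
  shows "cost p (trunc n x) x = Lp_norm p (count_space UNIV) (\<lambda>i. if i < n then 0 else pt_dist p (x i) None)"
  unfolding cost_def by (rule arg_cong[where f = "Lp_norm p (count_space UNIV)"])
    (auto simp: trunc_def pt_dist_refl assms pt_dist_commute)

text \<open>A listing that has only basepoints outside a set of size \<open>2 n\<close> restricts to a reordering of any
  other such listing of the same diagram: the fibre over the basepoint has the right size because all others do.\<close>

lemma extend_rep_bij:
  assumes u: "is_sum \<alpha> u" "is_sum \<alpha> (trunc n x)" and T: "finite T" "card T = n + n" "{i. u i \<noteq> None} \<subseteq> T"
  shows "\<exists>h. bij_betw h {..<n + n} T \<and> (\<forall>i\<in>{..<n + n}. u (h i) = trunc n x i)"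
proof (rule glue_fibre_bijections)
  fix w
  have sub: "{i. trunc n x i \<noteq> None} \<subseteq> {..<n + n}" by (auto simp: trunc_def split: if_splits)
  show "\<exists>h. bij_betw h {i \<in> {..<n + n}. trunc n x i = w} {j \<in> T. u j = w}"
  proof (cases w)
    case (Some z)
    have "{i \<in> {..<n + n}. trunc n x i = w} = {i. trunc n x i = Some z}" "{j \<in> T. u j = w} = {j. u j = Some z}"
      using T(3) Some by (auto simp: trunc_def split: if_splits)
    then show ?thesis using is_sum_fibre_bij[OF u(2,1)] by simp
  next
    case None
    obtain h where h: "bij_betw h {i. trunc n x i \<noteq> None} {i. u i \<noteq> None}"
      using is_sum_support_bij[OF u(2,1)] by blast
    have "{i \<in> {..<n + n}. trunc n x i = w} = {..<n + n} - {i. trunc n x i \<noteq> None}" 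
      unfolding None by (rule set_eqI) (simp only: mem_Collect_eq Diff_iff not_not)
    moreover have "{j \<in> T. u j = w} = T - {i. u i \<noteq> None}" 
      unfolding None by (rule set_eqI) (simp only: mem_Collect_eq Diff_iff not_not)
    ultimately have "card {i \<in> {..<n + n}. trunc n x i = w} = card {j \<in> T. u j = w}"
      using T sub bij_betw_same_card[OF h] by (simp add: card_Diff_subset finite_subset)
    then show ?thesis using T by (intro finite_same_card_bij) auto
  qed
qed

text \<open>A permutation of the slots gives a coupling. Conversely, both listings of a coupling of diagrams
  with at most \<open>n\<close> points have only basepoints outside some set \<open>T\<close> of \<open>2 n\<close> indices; reordering \<open>T\<close> in two ways, so that one
  or the other listing becomes the given one, gives the permutation.\<close>

lemma W_fin_eq_coupling_dist:
  assumes p: "1 \<le> p" and x: "is_sum \<alpha> (trunc n x)" and y: "is_sum \<beta> (trunc n y)"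
  shows "W_fin p n x n y = coupling_dist p \<alpha> \<beta>"
proof -
  let ?N = "{..<n + n}"
  let ?c = "\<lambda>s. Lp_norm p (count_space ?N) (\<lambda>i. pt_dist p (trunc n x i) (trunc n y (s i)))"
  have W: "W_fin p n x n y = Min (?c ` {s. s permutes ?N})"
    by (simp add: W_fin_def Let_def trunc_def[abs_def])
  have fin: "finite (?c ` {s. s permutes ?N})" "?c ` {s. s permutes ?N} \<noteq> {}"
    using permutes_id[of ?N] by (simp add: finite_permutations, blast)
  show ?thesis
  proof (rule antisym)
    show "coupling_dist p \<alpha> \<beta> \<le> W_fin p n x n y"
      unfolding W
    proof (subst Min_ge_iff[OF fin], safe)
      fix s assume s: "s permutes ?N"
      have "coupling_dist p \<alpha> \<beta> \<le> cost p (trunc n x) (\<lambda>i. trunc n y (s i))"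
        by (rule coupling_dist_le_cost[OF x is_sum_reindex[OF y permutes_bij[OF s]]])
      also have "\<dots> \<le> ?c s"
        unfolding cost_def
      proof (rule Lp_norm_count_space_inj_le[OF p, where h = "\<lambda>i. i"])
        have "pt_dist p (trunc n x i) (trunc n y (s i)) = 0" if "i \<notin> ?N" for i
          using that permutes_not_in[OF s that] by (simp add: trunc_def pt_dist_refl p)
        then show "(\<lambda>i. i) ` {i \<in> UNIV. pt_dist p (trunc n x i) (trunc n y (s i)) \<noteq> 0} \<subseteq> ?N" by auto
      qed auto
      finally show "coupling_dist p \<alpha> \<beta> \<le> ?c s" .
    qed
    show "W_fin p n x n y \<le> coupling_dist p \<alpha> \<beta>"
      unfolding coupling_dist_def
    proof (rule INF_greatest, clarify)
      fix u v assume u: "is_sum \<alpha> u" and v: "is_sum \<beta> v"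
      have small: "finite {i. u i \<noteq> None} \<and> card {i. u i \<noteq> None} \<le> n"
        if reps: "is_sum \<alpha> (trunc n x)" "is_sum \<alpha> u" for \<alpha> x u
      proof -
        obtain h where h: "bij_betw h {i. trunc n x i \<noteq> None} {i. u i \<noteq> None}"
          using is_sum_support_bij[OF reps] by blast
        have sub: "{i. trunc n x i \<noteq> None} \<subseteq> {..<n}" by (auto simp: trunc_def split: if_splits)
        then show ?thesis
          using bij_betw_finite[OF h] bij_betw_same_card[OF h] card_mono[OF _ sub] finite_subset[OF sub] by simp
      qed
      define S where "S = {i. u i \<noteq> None} \<union> {i. v i \<noteq> None}"
      have S: "finite S" "card S \<le> n + n"
        using small[OF x u] small[OF y v] card_Un_le[of "{i. u i \<noteq> None}" "{i. v i \<noteq> None}"]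
        by (auto simp: S_def)
      obtain T' where T': "finite T'" "card T' = n + n - card S" "T' \<subseteq> - S"
        using infinite_arbitrarily_large[of "- S"] S(1) by (auto simp: finite_compl)
      define T where "T = S \<union> T'"
      have T: "finite T" "card T = n + n"
        using S T' card_Un_disjoint[of S T'] by (auto simp: T_def)
      have sub: "{i. u i \<noteq> None} \<subseteq> T" "{i. v i \<noteq> None} \<subseteq> T" by (auto simp: T_def S_def)
      obtain h where h: "bij_betw h ?N T" "\<And>i. i \<in> ?N \<Longrightarrow> u (h i) = trunc n x i"
        using extend_rep_bij[OF u x T sub(1)] by blast
      obtain k where k: "bij_betw k ?N T" "\<And>i. i \<in> ?N \<Longrightarrow> v (k i) = trunc n y i"
        using extend_rep_bij[OF v y T sub(2)] by blast
      define s where "s i = (if i \<in> ?N then inv_into ?N k (h i) else i)" for i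
      have "bij_betw (inv_into ?N k \<circ> h) ?N ?N"
        by (rule bij_betw_trans[OF h(1) bij_betw_inv_into[OF k(1)]])
      then have "bij_betw s ?N ?N" by (rule iffD1[OF bij_betw_cong, rotated]) (simp add: s_def)
      then have perm: "s permutes ?N" by (rule bij_imp_permutes) (simp add: s_def)
      have s: "trunc n y (s i) = v (h i)" if "i \<in> ?N" for i
      proof -
        have "s i \<in> ?N" "k (s i) = h i"
          using that \<open>bij_betw s ?N ?N\<close> h(1) k(1) bij_betw_inv_into_right[OF k(1), of "h i"]
          by (auto simp: s_def bij_betw_def)
        then show ?thesis using k(2)[of "s i"] by simp
      qed
      have "W_fin p n x n y \<le> ?c s" unfolding W using fin perm by (intro Min_le) auto
      also have "\<dots> \<le> cost p u v"
        unfolding cost_def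
      proof (rule Lp_norm_count_space_inj_le[OF p, where h = h])
        have "inj_on h ?N" using h(1) by (rule bij_betw_imp_inj_on)
        then show "inj_on h {i \<in> ?N. pt_dist p (trunc n x i) (trunc n y (s i)) \<noteq> 0}"
          by (rule inj_on_subset) auto
        show "\<bar>pt_dist p (trunc n x i) (trunc n y (s i))\<bar> \<le> \<bar>pt_dist p (u (h i)) (v (h i))\<bar>" if "i \<in> ?N" for i
          using h(2)[OF that] s[OF that] by simp
      qed simp
      finally show "W_fin p n x n y \<le> cost p u v" .
    qed
  qed
qed

text \<open>Finiteness of a diagram is stated for some listing, whereas the landscape and the Wasserstein
  distance quantify over all of them.\<close>

lemma p_finite_seq_transfer:
  assumes p: "1 \<le> p" and x: "is_sum \<alpha> x" and y: "is_sum \<alpha> y" and fin: "p_finite_seq p x"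
  shows "p_finite_seq p y"
proof -
  obtain h where h: "inj_on h {i. y i \<noteq> None}" "\<And>i. y i \<noteq> None \<Longrightarrow> x (h i) = y i"
    using is_sum_support_bij[OF y x] unfolding bij_betw_def by blast
  have supp: "y i \<noteq> None" if "pt_dist p (y i) None \<noteq> 0" for i
    using that pt_dist_refl[OF p, of None] by metis
  show ?thesis
  proof (cases "p = \<infinity>")
    case False
    have "Lp_norm p (count_space UNIV) (\<lambda>i. pt_dist p (y i) None)
        \<le> Lp_norm p (count_space UNIV) (\<lambda>i. pt_dist p (x i) None)"
    proof (rule Lp_norm_count_space_inj_le[OF p, where h = h])
      show "inj_on h {i \<in> UNIV. pt_dist p (y i) None \<noteq> 0}"
        by (rule inj_on_subset[OF h(1)]) (use supp in blast)
      show "\<bar>pt_dist p (y i) None\<bar> \<le> \<bar>pt_dist p (x (h i)) None\<bar>" if "pt_dist p (y i) None \<noteq> 0" for i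
        using h(2)[OF supp[OF that]] by simp
    qed simp
    then show ?thesis using fin False by (auto simp: p_finite_seq_def)
  next
    case True
    have "finite {i. e \<le> pt_dist p (y i) None}" if "0 < e" for e
    proof (rule inj_on_finite)
      have "{i. e \<le> pt_dist p (y i) None} \<subseteq> {i. y i \<noteq> None}" using supp that by force
      then show "inj_on h {i. e \<le> pt_dist p (y i) None}" using h(1) by (rule inj_on_subset[rotated])
      show "h ` {i. e \<le> pt_dist p (y i) None} \<subseteq> {i. e \<le> pt_dist p (x i) None}"
        using h(2) supp that by force
      have "\<forall>\<^sub>F i in sequentially. pt_dist p (x i) None < e"
        using fin True that by (auto simp: p_finite_seq_def intro: order_tendstoD)
      then show "finite {i. e \<le> pt_dist p (x i) None}"
        by (simp add: cofinite_eq_sequentially[symmetric] eventually_cofinite not_less)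
    qed
    then have "\<forall>\<^sub>F i in sequentially. pt_dist p (y i) None < e" if "0 < e" for e
      using that by (simp add: cofinite_eq_sequentially[symmetric] eventually_cofinite not_less)
    then have "(\<lambda>i. pt_dist p (y i) None) \<longlonglongrightarrow> 0"
      by (intro order_tendstoI) (auto intro!: always_eventually order_less_le_trans[OF _ pt_dist_nonneg])
    then show ?thesis using True by (simp add: p_finite_seq_def)
  qed
qed

lemma cost_trunc_tendsto_0:
  assumes "1 \<le> p" "p_finite_seq p x"
  shows "(\<lambda>n. cost p (trunc n x) x) \<longlonglongrightarrow> 0"
  unfolding cost_trunc[OF assms(1)]
  by (rule Lp_norm_tail_tendsto_0) (use assms in \<open>auto simp: p_finite_seq_def\<close>)

text \<open>By the triangle inequality, the distance of the truncations differs from that of the diagrams by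
  at most the norms of the two tails.\<close>

lemma W_fin_tendsto:
  assumes p: "1 \<le> p" and x: "is_sum \<alpha> x" "p_finite_seq p x" and y: "is_sum \<beta> y" "p_finite_seq p y"
  shows "(\<lambda>n. W_fin p n x n y) \<longlonglongrightarrow> coupling_dist p \<alpha> \<beta>"
proof -
  define t where "t n = cost p (trunc n x) x + cost p (trunc n y) y" for n
  have t: "t \<longlonglongrightarrow> 0"
    unfolding t_def using tendsto_add[OF cost_trunc_tendsto_0[OF p x(2)] cost_trunc_tendsto_0[OF p y(2)]] by simp
  let ?D = "coupling_dist p \<alpha> \<beta>"
  have W: "W_fin p n x n y = coupling_dist p (diagram_of (trunc n x)) (diagram_of (trunc n y))" for n
    by (rule W_fin_eq_coupling_dist[OF p is_sum_trunc[OF x(1)] is_sum_trunc[OF y(1)]])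
  have b: "coupling_dist p (diagram_of (trunc n z)) \<gamma> \<le> cost p (trunc n z) z"
      "coupling_dist p \<gamma> (diagram_of (trunc n z)) \<le> cost p (trunc n z) z" if "is_sum \<gamma> z" for n z \<gamma>
    using coupling_dist_le_cost[OF is_sum_trunc[OF that] that]
      coupling_dist_le_cost[OF that is_sum_trunc[OF that]] cost_commute by metis+
  have up: "W_fin p n x n y \<le> ?D + t n" for n
  proof -
    have "W_fin p n x n y \<le> coupling_dist p (diagram_of (trunc n x)) \<alpha>
        + (?D + coupling_dist p \<beta> (diagram_of (trunc n y)))"
      unfolding W 
      by (rule order_trans[OF coupling_dist_triangle[OF p, where \<beta> = \<alpha>] add_left_mono[OF coupling_dist_triangle[OF p]]])
    also have "\<dots> \<le> cost p (trunc n x) x + (?D + cost p (trunc n y) y)"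
      by (intro add_mono b x y order_refl)
    finally show ?thesis by (simp add: t_def ac_simps)
  qed
  have lo: "?D \<le> W_fin p n x n y + t n" for n
  proof -
    have "?D \<le> coupling_dist p \<alpha> (diagram_of (trunc n x))
        + (W_fin p n x n y + coupling_dist p (diagram_of (trunc n y)) \<beta>)"
      unfolding W 
      by (rule order_trans[OF coupling_dist_triangle[OF p] add_left_mono[OF coupling_dist_triangle[OF p]]])
    also have "\<dots> \<le> cost p (trunc n x) x + (W_fin p n x n y + cost p (trunc n y) y)"
      by (intro add_mono b x y order_refl)
    finally show ?thesis by (simp add: t_def ac_simps)
  qed
  show ?thesis
  proof (rule order_tendstoI)
    fix a assume a: "a < ?D"
    have "(\<lambda>n. a + t n) \<longlonglongrightarrow> a + 0" by (intro tendsto_add tendsto_const t)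
    then have "\<forall>\<^sub>F n in sequentially. a + t n < ?D" using a by (intro order_tendstoD) auto
    then show "\<forall>\<^sub>F n in sequentially. a < W_fin p n x n y"
    proof eventually_elim
      case (elim n)
      then have "a + t n < W_fin p n x n y + t n" using lo[of n] by (rule order_less_le_trans)
      then show ?case by (meson add_right_mono not_le)
    qed
  next
    fix a assume a: "?D < a"
    have "(\<lambda>n. ?D + t n) \<longlonglongrightarrow> ?D + 0" by (intro tendsto_add tendsto_const t)
    then have "\<forall>\<^sub>F n in sequentially. ?D + t n < a" using a by (intro order_tendstoD) auto
    then show "\<forall>\<^sub>F n in sequentially. W_fin p n x n y < a"
      by eventually_elim (use up in \<open>rule order_le_less_trans\<close>)
  qed
qed

lemma W_eq_coupling_dist:
  assumes p: "1 \<le> p" and "\<alpha> \<in> p_finite_diagrams p" "\<beta> \<in> p_finite_diagrams p"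
  shows "W p \<alpha> \<beta> = coupling_dist p \<alpha> \<beta>"
proof -
  obtain x y where x: "is_sum \<alpha> x" "p_finite_seq p x" and y: "is_sum \<beta> y" "p_finite_seq p y"
    using assms by (auto simp: p_finite_diagrams_def)
  have lim: "(\<lambda>n. W_fin p n x' n y') \<longlonglongrightarrow> coupling_dist p \<alpha> \<beta>" if "is_sum \<alpha> x'" "is_sum \<beta> y'" for x' y'
    using that p_finite_seq_transfer[OF p] x y by (intro W_fin_tendsto p) blast+
  show ?thesis
    unfolding W_def
  proof (rule the_equality)
    fix w assume "\<forall>x y. is_sum \<alpha> x \<longrightarrow> is_sum \<beta> y \<longrightarrow> (\<lambda>n. W_fin p n x n y) \<longlonglongrightarrow> w"
    then show "w = coupling_dist p \<alpha> \<beta>" using lim[OF x(1) y(1)] x y LIMSEQ_unique by blast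
  qed (use lim in blast)
qed

section \<open>The landscape is 1-Lipschitz\<close>

lemma p_finite_seq_tendsto_0:
  assumes p: "1 \<le> p" and "p_finite_seq p x"
  shows "(\<lambda>i. pt_dist p (x i) None) \<longlonglongrightarrow> 0"
proof (rule order_tendstoI)
  fix e :: real assume e: "0 < e"
  have "\<forall>\<^sub>F n in sequentially. cost p (trunc n x) x < ennreal e"
    using cost_trunc_tendsto_0[OF assms] e by (intro order_tendstoD) auto
  then show "\<forall>\<^sub>F i in sequentially. pt_dist p (x i) None < e"
  proof eventually_elim
    case (elim n)
    have "ennreal \<bar>if n < n then 0 else pt_dist p (x n) None\<bar> \<le> cost p (trunc n x) x"
      unfolding cost_trunc[OF p] by (rule le_Lp_norm_count_space[OF p, where f = "\<lambda>i. if i < n then 0 else pt_dist p (x i) None"]) simp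
    with elim have "ennreal (pt_dist p (x n) None) < ennreal e" by (simp add: pt_dist_nonneg)
    then show ?case using e by (simp add: ennreal_less_iff pt_dist_nonneg)
  qed
qed (auto intro!: always_eventually order_less_le_trans[OF _ pt_dist_nonneg])

text \<open>This is all that the construction of the landscape needs of \<open>p\<close>-finiteness: above every positive
  level there are finitely many triangles.\<close>

lemma finite_large_triangles:
  assumes p: "1 \<le> p" and "p_finite_seq p x" and s: "0 < s"
  shows "finite {i. \<exists>t. s \<le> triangle (x i) t}"
proof -
  obtain \<delta> where \<delta>: "0 < \<delta>" "\<And>x t. s \<le> triangle x t \<Longrightarrow> \<delta> \<le> pt_dist p x None"
    using pt_dist_None_lower_bound[OF p s] by blast
  have "\<forall>\<^sub>F i in sequentially. pt_dist p (x i) None < \<delta>"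
    using p_finite_seq_tendsto_0[OF assms(1,2)] \<delta>(1) by (intro order_tendstoD) auto
  then have "finite {i. \<delta> \<le> pt_dist p (x i) None}"
    by (simp add: cofinite_eq_sequentially[symmetric] eventually_cofinite not_less)
  then show ?thesis by (rule rev_finite_subset) (use \<delta>(2) in auto)
qed

lemma finite_triangles_above:
  assumes p: "1 \<le> p" and "p_finite_seq p x" and s: "0 < s"
  shows "finite {i. s < ennreal (triangle (x i) t)}"
proof (cases s)
  case (real r)
  then have "0 < r" using s by (simp add: ennreal_less_zero_iff)
  show ?thesis
    by (rule finite_subset[OF _ finite_large_triangles[OF assms(1,2) \<open>0 < r\<close>]])
      (use real in \<open>auto simp: ennreal_less_iff intro: less_imp_le\<close>)
qed simp

lemma kth_triangles_finite:
  assumes p: "1 \<le> p" and "p_finite_seq p x" and k: "1 \<le> k"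
  shows "kth k (\<lambda>i. ennreal (triangle (x i) t)) < \<infinity>"
proof (cases "0 < kth k (\<lambda>i. ennreal (triangle (x i) t))")
  case True
  then obtain i where "ennreal (triangle (x i) t) = kth k (\<lambda>i. ennreal (triangle (x i) t))"
    using kth_attained[OF finite_triangles_above[OF assms(1,2)] k] by blast
  then show ?thesis by (metis ennreal_less_top infinity_ennreal_def)
qed simp

lemma kth_triangles_rep_le:
  assumes "is_sum \<alpha> x" "is_sum \<alpha> y" and k: "1 \<le> k"
  shows "kth k (\<lambda>i. ennreal (triangle (x i) t)) \<le> kth k (\<lambda>i. ennreal (triangle (y i) t))"
proof -
  obtain h where h: "inj_on h {i. x i \<noteq> None}" "\<And>i. x i \<noteq> None \<Longrightarrow> y (h i) = x i"
    using is_sum_support_bij[OF assms(1,2)] unfolding bij_betw_def by blast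
  have supp: "x i \<noteq> None" if "ennreal (triangle (x i) t) \<noteq> 0" for i
  proof
    assume "x i = None"
    then show False using that by simp
  qed
  show ?thesis
  proof (rule kth_mono_inj[OF k, where h = h])
    show "inj_on h {i. ennreal (triangle (x i) t) \<noteq> 0}"
      by (rule inj_on_subset[OF h(1)]) (use supp in blast)
    show "ennreal (triangle (x i) t) \<le> ennreal (triangle (y (h i)) t)"
      if "ennreal (triangle (x i) t) \<noteq> 0" for i
      using h(2)[OF supp[OF that]] by simp
  qed
qed

lemma landscape_eq_kth:
  assumes p: "1 \<le> p" and x: "is_sum \<alpha> x" "p_finite_seq p x" and k: "1 \<le> k"
  shows "landscape \<alpha> (k, t) = enn2real (kth k (\<lambda>i. ennreal (triangle (x i) t)))"
proof -
  have "kmax k (\<lambda>i. ennreal (triangle (y i) t)) = kth k (\<lambda>i. ennreal (triangle (x i) t))"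
    if y: "is_sum \<alpha> y" for y
  proof -
    have "p_finite_seq p y" using p_finite_seq_transfer[OF p x(1) y x(2)] .
    then have "kmax k (\<lambda>i. ennreal (triangle (y i) t)) = kth k (\<lambda>i. ennreal (triangle (y i) t))"
      by (intro kmax_eq_kth k finite_triangles_above[OF p])
    also have "\<dots> = kth k (\<lambda>i. ennreal (triangle (x i) t))"
      by (rule antisym[OF kth_triangles_rep_le[OF y x(1) k] kth_triangles_rep_le[OF x(1) y k]])
    finally show ?thesis .
  qed
  then have "(THE v. \<forall>y. is_sum \<alpha> y \<longrightarrow> v = kmax k (\<lambda>j. ennreal (triangle (y j) t)))
      = kth k (\<lambda>i. ennreal (triangle (x i) t))"
    using x(1) by (intro the_equality) auto
  then show ?thesis by (simp add: landscape_def)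
qed

lemma kth_measurable:
  assumes [measurable]: "\<And>i. f i \<in> borel_measurable M"
  shows "(\<lambda>t. kth k (\<lambda>i. f i t)) \<in> borel_measurable M"
  unfolding kth_def
proof (rule borel_measurable_SUP)
  have "countable {I::nat set. finite I}" by (rule countable_Collect_finite)
  then show "countable {I::nat set. finite I \<and> card I = k}"
    by (rule countable_subset[rotated]) auto
  fix I :: "nat set" assume "I \<in> {I. finite I \<and> card I = k}"
  then show "(\<lambda>t. INF i\<in>I. f i t) \<in> borel_measurable M"
    by (intro borel_measurable_INF) (auto intro: countable_finite)
qed

lemma landscape_measurable:
  assumes p: "1 \<le> p" and x: "is_sum \<alpha> x" "p_finite_seq p x"
  shows "landscape \<alpha> \<in> borel_measurable landscape_measure"
  unfolding landscape_measure_def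
proof (rule measurable_pair_measure_countable1)
  fix k :: nat assume k: "k \<in> {1..}"
  have "(\<lambda>t. enn2real (kth k (\<lambda>i. ennreal (triangle (x i) t)))) \<in> borel_measurable lborel"
    by (intro measurable_compose[OF _ borel_measurable_enn2real] kth_measurable) measurable
  then show "(\<lambda>t. landscape \<alpha> (k, t)) \<in> borel_measurable lborel"
    using landscape_eq_kth[OF p x] k by simp
qed auto

interpretation landscape_pair: pair_sigma_finite "count_space {1::nat..}" "lborel :: real measure"
  by (intro pair_sigma_finite.intro sigma_finite_measure_count_space lborel.sigma_finite_measure_axioms)

text \<open>Pointwise in \<open>t\<close> this is the inequality for rearranged sequences; for finite \<open>p\<close> it is
  integrated over \<open>t\<close>, with Tonelli's theorem used on both sides.\<close>

lemma Lp_norm_landscape_diff_le_cost: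
  assumes p: "1 \<le> p" and u: "is_sum \<alpha> u" "p_finite_seq p u" and v: "is_sum \<beta> v" "p_finite_seq p v"
  shows "Lp_norm p landscape_measure (\<lambda>z. landscape \<alpha> z - landscape \<beta> z) \<le> cost p u v"
proof (rule ennreal_le_by_bounds)
  have [measurable]: "landscape \<alpha> \<in> borel_measurable (count_space {1..} \<Otimes>\<^sub>M lborel)"
    "landscape \<beta> \<in> borel_measurable (count_space {1..} \<Otimes>\<^sub>M lborel)"
    using landscape_measurable[OF p u] landscape_measurable[OF p v] by (simp_all add: landscape_measure_def)
  note kfin = kth_triangles_finite[OF p u(2)] kth_triangles_finite[OF p v(2)]
  have diff: "landscape \<alpha> (k, t) - landscape \<beta> (k, t) = enn2real (kth k (\<lambda>i. ennreal (triangle (u i) t)))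
      - enn2real (kth k (\<lambda>i. ennreal (triangle (v i) t)))" if "k \<in> {1..}" for k t
    using landscape_eq_kth[OF p u, of k t] landscape_eq_kth[OF p v, of k t] that by simp
  fix c :: real assume c: "0 \<le> c" "cost p u v \<le> ennreal c"
  show "Lp_norm p landscape_measure (\<lambda>z. landscape \<alpha> z - landscape \<beta> z) \<le> ennreal c"
  proof (cases "p = \<infinity>")
    case True
    have d: "pt_dist p (u i) (v i) \<le> c" for i
      using c True by (auto simp: cost_def Lp_norm_top_le_iff AE_count_space dest: abs_le_D1)
    have "AE t in lborel. \<bar>triangle (u i) t - triangle (v i) t\<bar> \<le> c" for i
    proof (subst Lp_norm_top_le_iff[OF True, symmetric])
      show "Lp_norm p lborel (\<lambda>t. triangle (u i) t - triangle (v i) t) \<le> ennreal c"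
        using d[of i] by (simp add: ennreal_leI flip: ennreal_pt_dist[OF p])
    qed (use c in auto)
    then have all: "AE t in lborel. \<forall>i. \<bar>triangle (u i) t - triangle (v i) t\<bar> \<le> c"
      by (simp add: AE_all_countable)
    have ae: "AE t in lborel. \<bar>landscape \<alpha> (k, t) - landscape \<beta> (k, t)\<bar> \<le> c" if "k \<in> {1..}" for k
      using all
    proof eventually_elim
      case (elim t)
      then show ?case unfolding diff[OF that]
        using that by (intro kth_lipschitz kfin triangle_nonneg) auto
    qed
    have "AE z in landscape_measure. \<bar>landscape \<alpha> z - landscape \<beta> z\<bar> \<le> c"
      unfolding landscape_measure_def
    proof (rule landscape_pair.AE_pair_measure)
      show "{z \<in> space (count_space {1..} \<Otimes>\<^sub>M lborel). \<bar>landscape \<alpha> z - landscape \<beta> z\<bar> \<le> c}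
          \<in> sets (count_space {1..} \<Otimes>\<^sub>M lborel)" by measurable
      show "AE k in count_space {1..}. AE t in lborel. \<bar>landscape \<alpha> (k, t) - landscape \<beta> (k, t)\<bar> \<le> c"
        using ae by (simp add: AE_count_space)
    qed
    moreover have "(\<lambda>z. landscape \<alpha> z - landscape \<beta> z) \<in> borel_measurable landscape_measure"
      unfolding landscape_measure_def by measurable
    ultimately show ?thesis using c by (subst Lp_norm_top_le_iff[OF True])
  next
    case False
    define q where "q = enn2real p"
    have q: "1 \<le> q" using enn2real_ge_1[OF p False] by (simp add: q_def)
    have "(\<integral>\<^sup>+ z. ennreal (\<bar>landscape \<alpha> z - landscape \<beta> z\<bar> powr q) \<partial>landscape_measure)
      = (\<integral>\<^sup>+ t. \<integral>\<^sup>+ k. ennreal (\<bar>landscape \<alpha> (k, t) - landscape \<beta> (k, t)\<bar> powr q) \<partial>count_space {1..} \<partial>lborel)"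
      unfolding landscape_measure_def by (rule landscape_pair.nn_integral_snd[symmetric]) measurable
    also have "\<dots> \<le> (\<integral>\<^sup>+ t. \<integral>\<^sup>+ i. ennreal (\<bar>triangle (u i) t - triangle (v i) t\<bar> powr q) \<partial>count_space UNIV \<partial>lborel)"
    proof (rule nn_integral_mono)
      fix t
      have "(\<integral>\<^sup>+ k. ennreal (\<bar>landscape \<alpha> (k, t) - landscape \<beta> (k, t)\<bar> powr q) \<partial>count_space {1..})
        = (\<integral>\<^sup>+ k. ennreal (\<bar>enn2real (kth k (\<lambda>i. ennreal (triangle (u i) t)))
      - enn2real (kth k (\<lambda>i. ennreal (triangle (v i) t)))\<bar> powr q) \<partial>count_space {1..})"
        by (intro nn_integral_cong) (simp add: diff)
      also have "\<dots> \<le> (\<integral>\<^sup>+ i. ennreal (\<bar>triangle (u i) t - triangle (v i) t\<bar> powr q) \<partial>count_space UNIV)"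
        by (intro kth_cost q triangle_nonneg kfin)
      finally show "(\<integral>\<^sup>+ k. ennreal (\<bar>landscape \<alpha> (k, t) - landscape \<beta> (k, t)\<bar> powr q) \<partial>count_space {1..})
        \<le> (\<integral>\<^sup>+ i. ennreal (\<bar>triangle (u i) t - triangle (v i) t\<bar> powr q) \<partial>count_space UNIV)" .
    qed
    also have "\<dots> = (\<integral>\<^sup>+ i. \<integral>\<^sup>+ t. ennreal (\<bar>triangle (u i) t - triangle (v i) t\<bar> powr q) \<partial>lborel \<partial>count_space UNIV)"
      unfolding nn_integral_count_space_nat by (rule nn_integral_suminf) measurable
    also have "\<dots> \<le> (\<integral>\<^sup>+ i. ennreal (\<bar>pt_dist p (u i) (v i)\<bar> powr q) \<partial>count_space UNIV)"
    proof (rule nn_integral_mono)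
      fix i
      show "(\<integral>\<^sup>+ t. ennreal (\<bar>triangle (u i) t - triangle (v i) t\<bar> powr q) \<partial>lborel)
          \<le> ennreal (\<bar>pt_dist p (u i) (v i)\<bar> powr q)"
        unfolding q_def using pt_dist_nonneg[of p "u i" "v i"]
        by (subst Lp_norm_le_iff[OF p False, symmetric]) (auto simp: ennreal_pt_dist[OF p])
    qed
    also have "\<dots> \<le> ennreal (c powr q)"
      using c unfolding cost_def q_def by (simp add: Lp_norm_le_iff[OF p False])
    finally show ?thesis unfolding q_def using c by (simp add: Lp_norm_le_iff[OF p False])
  qed
qed

section \<open>The landscape determines the diagram\<close>

lemma landscape_lipschitz_in_time:
  assumes p: "1 \<le> p" and x: "is_sum \<alpha> x" "p_finite_seq p x" and k: "1 \<le> k"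
  shows "\<bar>landscape \<alpha> (k, t) - landscape \<alpha> (k, t')\<bar> \<le> \<bar>t - t'\<bar>"
  unfolding landscape_eq_kth[OF p x k]
  by (intro kth_lipschitz k triangle_nonneg triangle_lipschitz kth_triangles_finite[OF p x(2)])

text \<open>A nonzero difference at \<open>t\<close> persists on an interval around \<open>t\<close>, by the Lipschitz bound.\<close>

lemma landscape_AE_eq_imp_eq:
  assumes p: "1 \<le> p" and x: "is_sum \<alpha> x" "p_finite_seq p x" and y: "is_sum \<beta> y" "p_finite_seq p y"
    and ae: "AE z in landscape_measure. landscape \<alpha> z = landscape \<beta> z" and k: "1 \<le> k"
  shows "landscape \<alpha> (k, t) = landscape \<beta> (k, t)"
proof (rule ccontr)
  assume ne: "landscape \<alpha> (k, t) \<noteq> landscape \<beta> (k, t)"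
  \<comment> \<open>by the triangle inequality, agreement at \<open>s\<close> forces \<open>3 * e \<le> 2 * \<bar>t - s\<bar>\<close>\<close>
  define e where "e = \<bar>landscape \<alpha> (k, t) - landscape \<beta> (k, t)\<bar> / 3"
  have e: "0 < e" using ne by (simp add: e_def)
  have "AE k in count_space {1..}. AE t in lborel. landscape \<alpha> (k, t) = landscape \<beta> (k, t)"
    using ae unfolding landscape_measure_def by (rule landscape_pair.AE_pair)
  then have "AE s in lborel. landscape \<alpha> (k, s) = landscape \<beta> (k, s)"
    using k by (simp add: AE_count_space)
  then have "AE s in lborel. s \<notin> {t - e..t + e}"
  proof eventually_elim
    case (elim s)
    have "\<bar>a - b\<bar> \<le> 2 * D" if "\<bar>a - c\<bar> \<le> D" "\<bar>b - c'\<bar> \<le> D" "c = c'" for a b c c' D :: real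
      using that by linarith
    from this[OF landscape_lipschitz_in_time[OF p x k] landscape_lipschitz_in_time[OF p y k] elim]
    have "\<bar>landscape \<alpha> (k, t) - landscape \<beta> (k, t)\<bar> \<le> 2 * \<bar>t - s\<bar>" .
    then have "3 * e \<le> 2 * \<bar>t - s\<bar>" by (simp add: e_def)
    show ?case
    proof
      assume "s \<in> {t - e..t + e}"
      then have "\<bar>t - s\<bar> \<le> e" by (simp add: abs_le_iff)
      then show False using \<open>3 * e \<le> 2 * \<bar>t - s\<bar>\<close> e by simp
    qed
  qed
  then have "{t - e..t + e} \<in> null_sets lborel" by (subst AE_iff_null_sets) auto
  then show False using e by (auto simp: null_sets_def)
qed

text \<open>The points \<open>w\<close> whose interval contains that of \<open>z\<close>.\<close>

definition corner :: "real \<times> real \<Rightarrow> (real \<times> real) set" where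
  "corner z = {w. fst w \<le> fst z \<and> snd z \<le> snd w}"

text \<open>The level and the time are chosen such that the quadrant of \<open>le_triangle_iff\<close> has its corner
  at \<open>(b, d)\<close>.\<close>

lemma le_triangle_iff_corner:
  assumes "b < d"
  shows "(d - b) / 2 \<le> triangle x ((b + d) / 2) \<longleftrightarrow> x \<in> Some ` corner (b, d)"
proof (cases x)
  case None
  then show ?thesis using assms by auto
next
  case (Some w)
  obtain b' d' where w: "w = (b', d')" by (cases w)
  have "(d - b) / 2 \<le> triangle x ((b + d) / 2) \<longleftrightarrow> b' \<le> (b + d) / 2 - (d - b) / 2 \<and> (b + d) / 2 + (d - b) / 2 \<le> d'"
    unfolding Some w by (rule le_triangle_iff) (use assms in simp)
  also have "\<dots> \<longleftrightarrow> b' \<le> b \<and> d \<le> d'" by (simp add: field_simps)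
  finally show ?thesis by (auto simp: Some w corner_def)
qed

lemma finite_corner:
  assumes p: "1 \<le> p" and "p_finite_seq p x" and "b < d"
  shows "finite {i. x i \<in> Some ` corner (b, d)}"
proof -
  have "finite {i. \<exists>t. (d - b) / 2 \<le> triangle (x i) t}"
    by (rule finite_large_triangles[OF assms(1,2)]) (use assms(3) in simp)
  then show ?thesis
    unfolding le_triangle_iff_corner[OF assms(3), symmetric] by (rule rev_finite_subset) blast
qed

lemma card_corner_eq:
  assumes p: "1 \<le> p" and x: "p_finite_seq p x" and y: "p_finite_seq p y" and "b < d"
    and eq: "\<And>k t. 1 \<le> k \<Longrightarrow> kth k (\<lambda>i. ennreal (triangle (x i) t)) = kth k (\<lambda>i. ennreal (triangle (y i) t))"
  shows "card {i. x i \<in> Some ` corner (b, d)} = card {i. y i \<in> Some ` corner (b, d)}"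
proof -
  let ?s = "ennreal ((d - b) / 2)" and ?t = "(b + d) / 2"
  have s: "0 < ?s" using \<open>b < d\<close> by simp
  have sets: "{i. x i \<in> Some ` corner (b, d)} = {i. ?s \<le> ennreal (triangle (x i) ?t)}" for x :: "nat \<Rightarrow> point"
    unfolding le_triangle_iff_corner[OF \<open>b < d\<close>, symmetric] ennreal_le_iff[OF triangle_nonneg] ..
  have "k \<le> card {i. x i \<in> Some ` corner (b, d)} \<longleftrightarrow> k \<le> card {i. y i \<in> Some ` corner (b, d)}"
    if "1 \<le> k" for k
    unfolding sets
    using le_kth_iff[OF finite_triangles_above[OF p x] that s, of ?t]
      le_kth_iff[OF finite_triangles_above[OF p y] that s, of ?t] eq[OF that, of ?t] by simp
  then have "m \<le> card {i. x i \<in> Some ` corner (b, d)} \<longleftrightarrow> m \<le> card {i. y i \<in> Some ` corner (b, d)}" for m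
    by (cases m) simp_all
  from this[of "card {i. x i \<in> Some ` corner (b, d)}"] this[of "card {i. y i \<in> Some ` corner (b, d)}"]
  show ?thesis by simp
qed

text \<open>The closed quadrants with corner \<open>(b, d)\<close> contain equally many points of both diagrams. In the
  quadrant of a point where the multiplicities differ, there are finitely many such points; at one of them, \<open>z\<close>,
  the persistence \<open>d - b\<close> is greatest. All other points in the quadrant of \<open>z\<close> have greater persistence,
  so they have equal multiplicities, and then so has \<open>z\<close>.\<close>

lemma diagram_eq_if_kth_eq:
  assumes p: "1 \<le> p" and x: "is_sum \<alpha> x" "p_finite_seq p x" and y: "is_sum \<beta> y" "p_finite_seq p y"
    and eq: "\<And>k t. 1 \<le> k \<Longrightarrow> kth k (\<lambda>i. ennreal (triangle (x i) t)) = kth k (\<lambda>i. ennreal (triangle (y i) t))"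
  shows "\<alpha> = \<beta>"
proof (rule ccontr)
  assume "\<alpha> \<noteq> \<beta>"
  then obtain z0 where z0: "\<alpha> z0 \<noteq> \<beta> z0" by blast
  have hit: "z \<in> {z. \<exists>i. x i = Some z} \<union> {z. \<exists>i. y i = Some z}" if "\<alpha> z \<noteq> \<beta> z" for z
  proof (rule ccontr)
    assume "z \<notin> {z. \<exists>i. x i = Some z} \<union> {z. \<exists>i. y i = Some z}"
    then have "{i. x i = Some z} = {}" "{i. y i = Some z} = {}" by auto
    then have "\<alpha> z = \<beta> z" using x(1) y(1) unfolding is_sum_def by metis
    then show False using that by simp
  qed
  have above: "fst z < snd z" if ne: "\<alpha> z \<noteq> \<beta> z" for z
  proof -
    have "range x \<subseteq> points" "range y \<subseteq> points" using x(1) y(1) by (simp_all only: is_sum_def)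
    then have pts: "x i \<in> points" "y i \<in> points" for i by blast+
    obtain i where "x i = Some z \<or> y i = Some z" using hit[OF ne] by blast
    then have "Some z \<in> points" using pts[of i] by (elim disjE) simp_all
    then show ?thesis by (auto simp: points_def)
  qed
  have fin: "finite {i. x i \<in> Some ` corner z}" "finite {i. y i \<in> Some ` corner z}" if "fst z < snd z" for z
    using finite_corner[OF p x(2) that] finite_corner[OF p y(2) that] by simp_all
  \<comment> \<open>the points in the quadrant that occur in one of the diagrams, so that counts become sums over \<open>F z\<close>\<close>
  define F where "F z = {w \<in> corner z. (\<exists>i. x i = Some w) \<or> (\<exists>i. y i = Some w)}" for z
  have finF: "finite (F z)" if "fst z < snd z" for z
  proof (rule finite_subset)
    show "F z \<subseteq> the ` x ` {i. x i \<in> Some ` corner z} \<union> the ` y ` {i. y i \<in> Some ` corner z}"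
      unfolding F_def by (force simp: image_iff)
  qed (use fin[OF that] in auto)
  have "finite {z \<in> corner z0. \<alpha> z \<noteq> \<beta> z}"
    by (rule finite_subset[OF _ finF[OF above[OF z0]]]) (use hit in \<open>auto simp: F_def\<close>)
  moreover have "z0 \<in> {z \<in> corner z0. \<alpha> z \<noteq> \<beta> z}" using z0 by (simp add: corner_def)
  ultimately obtain z where z: "z \<in> corner z0" "\<alpha> z \<noteq> \<beta> z"
    and max: "\<And>w. w \<in> corner z0 \<Longrightarrow> \<alpha> w \<noteq> \<beta> w \<Longrightarrow> snd w - fst w \<le> snd z - fst z"
    using finite_has_maximum[of "{z \<in> corner z0. \<alpha> z \<noteq> \<beta> z}" "\<lambda>w. snd w - fst w"] by blast
  have agree: "\<alpha> w = \<beta> w" if "w \<in> corner z" "w \<noteq> z" for w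
  proof (rule ccontr)
    assume ne: "\<alpha> w \<noteq> \<beta> w"
    have "w \<in> corner z0" using that z by (auto simp: corner_def)
    then have "snd w - fst w \<le> snd z - fst z" using max ne by blast
    then have "w = z" using that(1) by (auto simp: corner_def prod_eq_iff)
    then show False using that by simp
  qed
  have zz: "fst z < snd z" "z \<in> F z" using above[OF z(2)] hit[OF z(2)] by (auto simp: F_def corner_def)
  have mult: "enat (card {i. u i = Some w}) = \<gamma> w" "finite {i. u i = Some w}"
    if "is_sum \<gamma> u" "finite {i. u i \<in> Some ` corner z}" "w \<in> corner z" for u \<gamma> w
  proof -
    show "finite {i. u i = Some w}" by (rule finite_subset[OF _ that(2)]) (use that in auto)
    then show "enat (card {i. u i = Some w}) = \<gamma> w" using that(1) by (simp only: is_sum_def if_True)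
  qed
  have count: "card {i. u i \<in> Some ` corner z} = (\<Sum>w\<in>F z. card {i. u i = Some w})"
    if "is_sum \<gamma> u" "finite {i. u i \<in> Some ` corner z}" "\<And>i w. u i = Some w \<Longrightarrow> w \<in> corner z \<Longrightarrow> w \<in> F z" for u \<gamma>
  proof -
    have "{i. u i \<in> Some ` corner z} = (\<Union>w\<in>F z. {i. u i = Some w})"
      using that(3) by (auto simp: F_def)
    also have "card \<dots> = (\<Sum>w\<in>F z. card {i. u i = Some w})"
      using finF[OF zz(1)] mult(2)[OF that(1,2)] by (intro card_UN_disjoint) (auto simp: F_def)
    finally show ?thesis .
  qed
  have "card {i. x i \<in> Some ` corner z} = card {i. y i \<in> Some ` corner z}"
    using card_corner_eq[OF p x(2) y(2) zz(1) eq] by simp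
  moreover have "card {i. x i \<in> Some ` corner z} = (\<Sum>w\<in>F z. card {i. x i = Some w})"
    by (rule count[OF x(1) fin(1)[OF zz(1)]]) (auto simp: F_def)
  moreover have "card {i. y i \<in> Some ` corner z} = (\<Sum>w\<in>F z. card {i. y i = Some w})"
    by (rule count[OF y(1) fin(2)[OF zz(1)]]) (auto simp: F_def)
  moreover have "card {i. x i = Some w} = card {i. y i = Some w}" if "w \<in> F z - {z}" for w
    using mult(1)[OF x(1) fin(1)[OF zz(1)], of w] mult(1)[OF y(1) fin(2)[OF zz(1)], of w] agree[of w] that
    by (auto simp: F_def simp flip: enat.inject)
  ultimately have "card {i. x i = Some z} = card {i. y i = Some z}"
    using sum.remove[OF finF[OF zz(1)] zz(2), of "\<lambda>w. card {i. x i = Some w}"]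
      sum.remove[OF finF[OF zz(1)] zz(2), of "\<lambda>w. card {i. y i = Some w}"] by simp
  moreover have "z \<in> corner z" by (simp add: corner_def)
  ultimately show False
    using mult(1)[OF x(1) fin(1)[OF zz(1)]] mult(1)[OF y(1) fin(2)[OF zz(1)]] z(2) by metis
qed

lemma landscape_injective:
  assumes p: "1 \<le> p" and "\<alpha> \<in> p_finite_diagrams p" "\<beta> \<in> p_finite_diagrams p"
    and ae: "AE z in landscape_measure. landscape \<alpha> z = landscape \<beta> z"
  shows "\<alpha> = \<beta>"
proof -
  obtain x y where x: "is_sum \<alpha> x" "p_finite_seq p x" and y: "is_sum \<beta> y" "p_finite_seq p y"
    using assms by (auto simp: p_finite_diagrams_def)
  have "kth k (\<lambda>i. ennreal (triangle (x i) t)) = kth k (\<lambda>i. ennreal (triangle (y i) t))" if k: "1 \<le> k" for k t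
  proof -
    have "enn2real (kth k (\<lambda>i. ennreal (triangle (x i) t))) = enn2real (kth k (\<lambda>i. ennreal (triangle (y i) t)))"
      using landscape_AE_eq_imp_eq[OF p x y ae k, of t]
      by (simp add: landscape_eq_kth[OF p x k] landscape_eq_kth[OF p y k])
    then show ?thesis
      using kth_triangles_finite[OF p x(2) k, of t] kth_triangles_finite[OF p y(2) k, of t]
      by (metis ennreal_enn2real infinity_ennreal_def)
  qed
  then show ?thesis by (rule diagram_eq_if_kth_eq[OF p x y])
qed

text \<open>The matching in which every point is unmatched is what \<open>p\<close>-finiteness is about.\<close>

lemma cost_None_finite:
  assumes p: "1 \<le> p" and "p_finite_seq p x"
  shows "cost p x (\<lambda>i. None) < \<infinity>"
proof (cases "p = \<infinity>")
  case True
  have "Bseq (\<lambda>i. pt_dist p (x i) None)"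
    using p_finite_seq_tendsto_0[OF assms] by (intro convergent_imp_Bseq) (auto simp: convergent_def)
  then obtain C where C: "0 < C" "\<And>i. \<bar>pt_dist p (x i) None\<bar> \<le> C" by (auto simp: Bseq_def)
  then have "cost p x (\<lambda>i. None) \<le> ennreal C"
    unfolding cost_def using True by (simp add: Lp_norm_top_le_iff AE_count_space)
  then show ?thesis by (auto simp: less_top[symmetric] top_unique)
next
  case False
  then show ?thesis using assms(2) by (simp add: p_finite_seq_def cost_def)
qed

text \<open>The landscape of the empty diagram vanishes, so the norm of a landscape is a distance to that
  of the empty diagram.\<close>

lemma landscape_in_Lp_space:
  assumes p: "1 \<le> p" and "\<alpha> \<in> p_finite_diagrams p"
  shows "landscape \<alpha> \<in> Lp_space p landscape_measure"
proof -
  obtain x where x: "is_sum \<alpha> x" "p_finite_seq p x"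
    using assms(2) by (auto simp: p_finite_diagrams_def)
  have zero: "is_sum (diagram_of (\<lambda>i. None)) (\<lambda>i. None)"
    by (rule is_sum_diagram_of) (auto simp: points_def)
  have zfin: "p_finite_seq p (\<lambda>i. None)"
    by (simp add: p_finite_seq_def pt_dist_refl Lp_norm_zero p)
  have null: "landscape (diagram_of (\<lambda>i. None)) (k, t) = 0" if "1 \<le> k" for k t
  proof -
    have "kth k (\<lambda>i. 0) = 0"
    proof -
      have "\<not> 0 < kth k (\<lambda>i. 0)" using that unfolding less_kth_iff[OF that] by auto
      then show ?thesis by simp
    qed
    then show ?thesis by (simp add: landscape_eq_kth[OF p zero zfin that])
  qed
  note meas = landscape_measurable[OF p x] landscape_measurable[OF p zero zfin]
  have "Lp_norm p landscape_measure (landscape \<alpha>)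
      \<le> Lp_norm p landscape_measure (\<lambda>z. landscape \<alpha> z - landscape (diagram_of (\<lambda>i. None)) z)"
  proof (rule Lp_norm_mono_AE[OF p meas(1) borel_measurable_diff[OF meas]], rule AE_I2)
    fix z assume "z \<in> space landscape_measure"
    then have "1 \<le> fst z" by (auto simp: landscape_measure_def space_pair_measure)
    then show "\<bar>landscape \<alpha> z\<bar> \<le> \<bar>landscape \<alpha> z - landscape (diagram_of (\<lambda>i. None)) z\<bar>"
      using null[of "fst z" "snd z"] by simp
  qed
  also have "\<dots> \<le> cost p x (\<lambda>i. None)" by (rule Lp_norm_landscape_diff_le_cost[OF p x zero zfin])
  also have "\<dots> < \<infinity>" by (rule cost_None_finite[OF p x(2)])
  finally show ?thesis using meas(1) by (simp add: Lp_space_def)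
qed

lemma landscape_1_lipschitz:
  assumes p: "1 \<le> p" and \<alpha>: "\<alpha> \<in> p_finite_diagrams p" and \<beta>: "\<beta> \<in> p_finite_diagrams p"
  shows "Lp_norm p landscape_measure (\<lambda>z. landscape \<alpha> z - landscape \<beta> z) \<le> W p \<alpha> \<beta>"
  unfolding W_eq_coupling_dist[OF assms] coupling_dist_def
proof (rule INF_greatest, clarify)
  fix u v assume uv: "is_sum \<alpha> u" "is_sum \<beta> v"
  moreover have "p_finite_seq p u" "p_finite_seq p v"
    using \<alpha> \<beta> uv p_finite_seq_transfer[OF p] unfolding p_finite_diagrams_def by blast+
  ultimately show "Lp_norm p landscape_measure (\<lambda>z. landscape \<alpha> z - landscape \<beta> z) \<le> cost p u v"
    by (intro Lp_norm_landscape_diff_le_cost p)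
qed

theorem theorem4p6:
  fixes p :: ennreal
  assumes "1 \<le> p"
  shows "(\<forall>\<alpha> \<in> p_finite_diagrams p. landscape \<alpha> \<in> Lp_space p landscape_measure) \<and>
    (\<forall>\<alpha> \<in> p_finite_diagrams p. \<forall>\<alpha>' \<in> p_finite_diagrams p.
       (AE z in landscape_measure. landscape \<alpha> z = landscape \<alpha>' z) \<longrightarrow> \<alpha> = \<alpha>') \<and>
    (\<forall>\<alpha> \<in> p_finite_diagrams p. \<forall>\<alpha>' \<in> p_finite_diagrams p.
       Lp_norm p landscape_measure (\<lambda>z. landscape \<alpha> z - landscape \<alpha>' z) \<le> W p \<alpha> \<alpha>')"
  using landscape_in_Lp_space[OF assms] landscape_injective[OF assms] landscape_1_lipschitz[OF assms]
  by blast

end
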